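(* Let $\mathfrak g$ be a finite-dimensional complex simple Lie algebra with Cartan matrix $(c_{ij})_{i,j\in\mathbb I^0}$. The twisted Yangian $\mathbf Y^\imath$ of split type associated with $\mathfrak g$ (defined in the context) is isomorphic to the $\mathbb C[\hbar]$-algebra generated by $h_{i,s},b_{j,r}$, for $s\in2\mathbb N+1$, $r\in\mathbb N$, $i,j\in\mathbb I^0$, subject to the relations $$[h_{i,s},h_{j,r}]=0,\qquad [h_{i,1},b_{j,r}]=2c_{ij}b_{j,r+1},$$ $$[b_{j,r},h_{i,s+2}]-[b_{j,r+2},h_{i,s}]=-\hbar d_ic_{ij}(b_{j,r+1}h_{i,s}+h_{i,s}b_{j,r+1})+\tfrac{\hbar^2d_i^2c_{ij}^2}{4}[b_{j,r},h_{i,s}],$$ $$[b_{i,s},b_{j,r+1}]-[b_{i,s+1},b_{j,r}]+\tfrac{\hbar d_ic_{ij}}{2}(b_{j,r}b_{i,s}+b_{i,s}b_{j,r})=2\delta_{ij}(-1)^sh_{i,r+s+1},$$ (with $h_{i,s}:=0$ for $s$ even; the third relation is for $s$ odd, the fourth for all $r,s\in\mathbb N$) and the finite type Serre relations $$[b_{i,0},b_{j,0}]=0\quad(c_{ij}=0),$$ $$[b_{i,0},[b_{i,0},b_{j,0}]]=-b_{j,0}\quad(c_{ij}=-1),$$ $$[b_{i,0},[b_{i,0},[b_{i,0},b_{j,0}]]]=-4[b_{i,0},b_{j,0}]\quad(c_{ij}=-2),$$ $$[b_{i,0},[b_{i,0},[b_{i,0},[b_{i,0},b_{j,0}]]]]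=-10[b_{i,0},[b_{i,0},b_{j,0}]]-9b_{j,0}\quad(c_{ij}=-3).$$
   Context: Conventions. $\mathbb N=\{0,1,2,\dots\}$; $\mathbb I^0=\{1,\dots,n\}$; $[A,B]=AB-BA$, $\{A,B\}=AB+BA$; $\delta_{k,ev}=1$ if $k$ is even and $0$ if $k$ is odd; the $d_i$ are coprime positive integers with $d_ic_{ij}=d_jc_{ji}$. $\mathrm{Sym}_{k_1,\dots,k_m}$ is the sum over all $m!$ permutations of the indices, $\mathrm{Cyc}_{k_1,k_2,k_3}$ the sum over the 3 cyclic permutations of $(k_1,k_2,k_3)$. Twisted Yangian $\mathbf Y^\imath$, type not $G_2$: the $\mathbb C[\hbar]$-algebra generated by $h_{i,s},b_{j,r}$ ($s\in2\mathbb N+1$, $r\in\mathbb N$, $i,j\in\mathbb I^0$), where one sets $h_{i,s}=0$ if $s$ is even or $s<0$, subject to $$(1)\ [h_{i,s},h_{j,r}]=0,\qquad (2)\ [h_{i,1},b_{j,r}]=2c_{ij}b_{j,r+1},$$ $$(3)\ [b_{j,r},h_{i,s+2}]-[b_{j,r+2},h_{i,s}]=-\hbar d_ic_{ij}\{b_{j,r+1},h_{i,s}\}+\tfrac{\hbar^2d_i^2c_{ij}^2}{4}[b_{j,r},h_{i,s}]\quad(s\text{ odd}),$$ $$(4)\ [b_{i,s},b_{j,r+1}]-[b_{i,s+1},b_{j,r}]+\tfrac{\hbar d_ic_{ij}}{2}\{b_{j,r},b_{i,s}\}=2\delta_{ij}(-1)^sh_{i,r+s+1}\quad(r,s\in\mathbb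 N),$$ and the Serre relations (for all indices in $\mathbb N$): if $c_{ij}=0$, $[b_{i,s},b_{j,r}]=0$; if $c_{ij}=-1$, $$\mathrm{Sym}_{k_1,k_2}[b_{i,k_1},[b_{i,k_2},b_{j,r}]]=\delta_{k_1+k_2,ev}(-1)^{k_1+1}\Big(2(\tfrac{\hbar d_i}{2})^{k_1+k_2}b_{j,r}+\sum_{t=0}^{\frac{k_1+k_2}{2}-1}(\tfrac{\hbar d_i}{2})^{2t}[b_{j,r+1},h_{i,k_1+k_2-2t-1}]+\sum_{t=0}^{\frac{k_1+k_2}{2}-1}2^{-2t}(\hbar d_i)^{2t+1}\{h_{i,k_1+k_2-2t-1},b_{j,r}\}\Big);$$ if $c_{ij}=-2$, $$\mathrm{Sym}_{k_1,k_2,k_3}[b_{i,k_1},[b_{i,k_2},[b_{i,k_3},b_{j,r}]]]=\mathrm{Cyc}_{k_1,k_2,k_3}\sum_{s\ge0}\sum_{p=0}^s(-1)^{k_3+p+1}\binom sp3^{-p-1}\hbar^{2s-2p}\,T_{s,p}$$ $$\qquad+8\,\mathrm{Cyc}_{k_1,k_2,k_3}\,\delta_{k_2+k_3,ev}\sum_{p=0}^{\frac{k_2+k_3}{2}}(-1)^{k_3+p+1}\binom{\frac{k_2+k_3}{2}}{p}3^{-p}\hbar^{k_2+k_3-2p}[b_{i,k_1+2p},b_{j,r}],$$ where, with $l=k_2+k_3-2s-1$, $$T_{s,p}=3[[b_{i,k_1+2p},b_{j,r+1}],h_{i,l}]+[[b_{i,k_1+2p+1},b_{j,r}],h_{i,l}]+6[b_{i,k_1+2p},[b_{j,r+1},h_{i,l}]]+2[b_{i,k_1+2p+1},[b_{j,r},h_{i,l}]]+3\hbar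 d_i[\{b_{i,k_1+2p},h_{i,l}\},b_{j,r}]+9\hbar d_i[b_{i,k_1+2p},\{h_{i,l},b_{j,r}\}].$$ Twisted Yangian of type $G_2$ ($\mathbb I^0=\{1,2\}$, $c_{21}=-3$, $c_{12}=-1$): the $\mathbb C[\hbar]$-algebra with the same generators, relations (1)--(4), and, for all $r\in\mathbb N$, $[b_{1,0},[b_{1,0},b_{2,r}]]=-b_{2,r}$ and $[b_{2,0},[b_{2,0},[b_{2,0},[b_{2,0},b_{1,r}]]]]=-10[b_{2,0},[b_{2,0},b_{1,r}]]-9b_{1,r}$. *)

theory Defs
  imports
    "HOL-Algebra.QuotRing"
    "HOL-Algebra.Module"
    "HOL-Library.Poly_Mapping"
    "HOL-Computational_Algebra.Polynomial"
begin

section \<open>Simple Lie algebras and their Cartan matrices\<close>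

locale complex_lie_algebra = vector_space scale
  for scale :: "complex \<Rightarrow> 'g::ab_group_add \<Rightarrow> 'g" +
  fixes bracket :: "'g \<Rightarrow> 'g \<Rightarrow> 'g"
  assumes bracket_linear_left: "Vector_Spaces.linear scale scale (\<lambda>x. bracket x y)"
    and bracket_linear_right: "Vector_Spaces.linear scale scale (bracket x)"
    and bracket_self: "bracket x x = 0"
    and jacobi: "bracket x (bracket y z) + bracket y (bracket z x) + bracket z (bracket x y) = 0"
begin

definition lie_ideal :: "'g set \<Rightarrow> bool" where
  "lie_ideal I \<longleftrightarrow> subspace I \<and> (\<forall>x. \<forall>y\<in>I. bracket x y \<in> I)"

definition lie_subalgebra :: "'g set \<Rightarrow> bool" where
  "lie_subalgebra U \<longleftrightarrow> subspace U \<and> (\<forall>x\<in>U. \<forall>y\<in>U. bracket x y \<in> U)"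

definition lie_generates :: "'g set \<Rightarrow> bool" where
  "lie_generates S \<longleftrightarrow> (\<forall>U. lie_subalgebra U \<and> S \<subseteq> U \<longrightarrow> U = UNIV)"

end

locale simple_complex_lie_algebra = complex_lie_algebra scale bracket
  for scale :: "complex \<Rightarrow> 'g::ab_group_add \<Rightarrow> 'g" and bracket +
  assumes finite_dimensional: "\<exists>B. finite B \<and> span B = UNIV"
    and not_abelian: "\<exists>x y. bracket x y \<noteq> 0"
    and simple: "lie_ideal I \<Longrightarrow> I = {0} \<or> I = UNIV"

text \<open>
  Indecomposable Cartan matrices of finite type. The symmetrised matrix
  \<open>(e\<^sub>i c\<^sub>i\<^sub>j)\<close> is the Gram matrix of the simple roots.
\<close>

definition indecomposable_finite_cartan_matrix :: "('i::finite \<Rightarrow> 'i \<Rightarrow> int) \<Rightarrow> bool" where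
  "indecomposable_finite_cartan_matrix c \<longleftrightarrow>
     (\<forall>i. c i i = 2) \<and>
     (\<forall>i j. i \<noteq> j \<longrightarrow> c i j \<le> 0) \<and>
     (\<forall>i j. c i j = 0 \<longrightarrow> c j i = 0) \<and>
     (\<exists>e :: 'i \<Rightarrow> real.
        (\<forall>i. 0 < e i) \<and>
        (\<forall>i j. e i * of_int (c i j) = e j * of_int (c j i)) \<and>
        (\<forall>x :: 'i \<Rightarrow> real. (\<exists>i. x i \<noteq> 0) \<longrightarrow>
           0 < (\<Sum>i\<in>UNIV. \<Sum>j\<in>UNIV. e i * of_int (c i j) * x i * x j))) \<and>
     (\<forall>J. J \<noteq> {} \<and> J \<noteq> UNIV \<longrightarrow> (\<exists>i\<in>J. \<exists>j\<in>-J. c i j \<noteq> 0))"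

text \<open>
  The Lie algebra has Cartan matrix \<open>c\<close> if it is generated by Chevalley generators
  \<open>e\<^sub>i, f\<^sub>i, h\<^sub>i\<close> for \<open>c\<close>. The convention is \<open>c\<^sub>i\<^sub>j = \<alpha>\<^sub>j(h\<^sub>i)\<close>. The Serre relations hold
  automatically, because the Lie algebra is finite-dimensional.
\<close>

definition (in complex_lie_algebra) has_cartan_matrix :: "('i::finite \<Rightarrow> 'i \<Rightarrow> int) \<Rightarrow> bool" where
  "has_cartan_matrix c \<longleftrightarrow>
     indecomposable_finite_cartan_matrix c \<and>
     (\<exists>e f h :: 'i \<Rightarrow> 'g.
        (\<forall>i j. bracket (h i) (h j) = 0) \<and>
        (\<forall>i j. bracket (h i) (e j) = scale (of_int (c i j)) (e j)) \<and>
        (\<forall>i j. bracket (h i) (f j) = scale (- of_int (c i j)) (f j)) \<and>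
        (\<forall>i j. bracket (e i) (f j) = (if i = j then h i else 0)) \<and>
        lie_generates (range e \<union> range f \<union> range h))"

definition coprime_symmetrizer :: "('i::finite \<Rightarrow> 'i \<Rightarrow> int) \<Rightarrow> ('i \<Rightarrow> nat) \<Rightarrow> bool" where
  "coprime_symmetrizer c d \<longleftrightarrow>
     (\<forall>i. 0 < d i) \<and> Gcd (range d) = 1 \<and>
     (\<forall>i j. int (d i) * c i j = int (d j) * c j i)"

text \<open>The labelling of the two nodes in type \<open>G\<^sub>2\<close> is left free.\<close>

definition type_G2 :: "('i::finite \<Rightarrow> 'i \<Rightarrow> int) \<Rightarrow> bool" where
  "type_G2 c \<longleftrightarrow> (\<exists>i j. UNIV = {i, j} \<and> i \<noteq> j \<and> c j i = - 3 \<and> c i j = - 1)"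


section \<open>Algebras over \<open>\<complex>[\<hbar>]\<close> given by generators and relations\<close>

text \<open>
  The free associative algebra over the polynomial ring \<open>complex poly\<close>, whose variable is
  \<open>\<hbar>\<close>, is the monoid algebra of the free monoid of words, written additively
  in order to use the convolution product of finitely supported functions.
\<close>

datatype 'x word = Word "'x list"

instantiation word :: (type) monoid_add
begin

definition zero_word :: "'a word" where
  "zero_word = Word []"

fun plus_word :: "'a word \<Rightarrow> 'a word \<Rightarrow> 'a word" where
  "plus_word (Word u) (Word v) = Word (u @ v)"

instance
proof
  fix a b c :: "'a word"
  show "a + b + c = a + (b + c)"
    by (cases a; cases b; cases c) simp
  show "0 + a = a"
    by (cases a) (simp add: zero_word_def)
  show "a + 0 = a"
    by (cases a) (simp add: zero_word_def)
qed

end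

type_synonym 'x free_alg = "'x word \<Rightarrow>\<^sub>0 complex poly"

definition gen :: "'x \<Rightarrow> 'x free_alg" where
  "gen x = Poly_Mapping.single (Word [x]) 1"

definition scal :: "complex poly \<Rightarrow> 'x free_alg" where
  "scal p = Poly_Mapping.single 0 p"

definition smul :: "complex poly \<Rightarrow> 'x free_alg \<Rightarrow> 'x free_alg" (infixr \<open>\<cdot>\<close> 75) where
  "p \<cdot> a = scal p * a"

definition free_algebra :: "(complex poly, 'x free_alg) module" where
  "free_algebra = \<lparr>carrier = UNIV, monoid.mult = (*), one = 1, zero = 0, add = (+), module.smult = smul\<rparr>"

text \<open>
  The quotient of the free algebra by the two-sided ideal generated by a set of relators.
  A scalar acts as multiplication by its coset.
\<close>

definition presented_algebra :: "'x free_alg set \<Rightarrow> (complex poly, 'x free_alg set) module" where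
  "presented_algebra R =
     (let I = genideal free_algebra R; Q = free_algebra Quot I
      in \<lparr>carrier = carrier Q, monoid.mult = monoid.mult Q, one = one Q, zero = zero Q, add = add Q,
          module.smult = (\<lambda>p X. (I +>\<^bsub>free_algebra\<^esub> scal p) \<otimes>\<^bsub>Q\<^esub> X)\<rparr>)"

definition algebra_isomorphic ::
    "(complex poly, 'a) module \<Rightarrow> (complex poly, 'b) module \<Rightarrow> bool" where
  "algebra_isomorphic A B \<longleftrightarrow>
     (\<exists>\<phi>\<in>ring_iso A B. \<forall>p. \<forall>x\<in>carrier A. \<phi> (p \<odot>\<^bsub>A\<^esub> x) = p \<odot>\<^bsub>B\<^esub> \<phi> x)"

definition comm :: "'a::ring \<Rightarrow> 'a \<Rightarrow> 'a" where
  "comm a b = a * b - b * a"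

definition acomm :: "'a::ring \<Rightarrow> 'a \<Rightarrow> 'a" where
  "acomm a b = a * b + b * a"


section \<open>Split twisted Yangians\<close>

text \<open>\<open>HGen i m\<close> is the generator \<open>h\<^bsub>i,2m+1\<^esub>\<close>, and \<open>BGen j r\<close> is the generator \<open>b\<^bsub>j,r\<^esub>\<close>.\<close>

datatype 'i generator = HGen 'i nat | BGen 'i nat

type_synonym 'i yfree = "'i generator free_alg"

definition h_gen :: "'i \<Rightarrow> int \<Rightarrow> 'i yfree" where
  "h_gen i s = (if odd s \<and> 0 < s then gen (HGen i (nat (s div 2))) else 0)"

definition b_gen :: "'i \<Rightarrow> nat \<Rightarrow> 'i yfree" where
  "b_gen j r = gen (BGen j r)"

text \<open>In all coefficients below, \<open>monom z k\<close> is \<open>z \<hbar>\<^sup>k\<close>.\<close>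

definition common_relators ::
    "('i::finite \<Rightarrow> 'i \<Rightarrow> int) \<Rightarrow> ('i \<Rightarrow> nat) \<Rightarrow> 'i yfree set" where
  "common_relators c d =
     {comm (h_gen i (int s)) (h_gen j (int r)) | i j s r. odd s \<and> odd r}
   \<union> {comm (h_gen i 1) (b_gen j r) - [:of_int (2 * c i j):] \<cdot> b_gen j (r + 1) | i j r. True}
   \<union> {comm (b_gen j r) (h_gen i (int s + 2)) - comm (b_gen j (r + 2)) (h_gen i (int s))
       - (- (monom (of_nat (d i) * of_int (c i j)) 1 \<cdot> acomm (b_gen j (r + 1)) (h_gen i (int s)))
          + monom ((of_nat (d i))\<^sup>2 * (of_int (c i j))\<^sup>2 / 4) 2 \<cdot> comm (b_gen j r) (h_gen i (int s)))
      | i j r s. odd s}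
   \<union> {comm (b_gen i s) (b_gen j (r + 1)) - comm (b_gen i (s + 1)) (b_gen j r)
       + monom (of_nat (d i) * of_int (c i j) / 2) 1 \<cdot> acomm (b_gen j r) (b_gen i s)
       - (if i = j then [:2 * (- 1) ^ s:] \<cdot> h_gen i (int (r + s + 1)) else 0)
      | i j r s. True}"

definition finite_serre_relators :: "('i::finite \<Rightarrow> 'i \<Rightarrow> int) \<Rightarrow> 'i yfree set" where
  "finite_serre_relators c =
     {comm (b_gen i 0) (b_gen j 0) | i j. c i j = 0}
   \<union> {comm (b_gen i 0) (comm (b_gen i 0) (b_gen j 0)) - (- b_gen j 0) | i j. c i j = - 1}
   \<union> {comm (b_gen i 0) (comm (b_gen i 0) (comm (b_gen i 0) (b_gen j 0)))
       - (- ([:4:] \<cdot> comm (b_gen i 0) (b_gen j 0))) | i j. c i j = - 2}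
   \<union> {comm (b_gen i 0) (comm (b_gen i 0) (comm (b_gen i 0) (comm (b_gen i 0) (b_gen j 0))))
       - (- ([:10:] \<cdot> comm (b_gen i 0) (comm (b_gen i 0) (b_gen j 0))) - [:9:] \<cdot> b_gen j 0)
      | i j. c i j = - 3}"

definition Sym2 :: "(nat \<Rightarrow> nat \<Rightarrow> 'a::ring) \<Rightarrow> nat \<Rightarrow> nat \<Rightarrow> 'a" where
  "Sym2 F k1 k2 = F k1 k2 + F k2 k1"

definition Sym3 :: "(nat \<Rightarrow> nat \<Rightarrow> nat \<Rightarrow> 'a::ring) \<Rightarrow> nat \<Rightarrow> nat \<Rightarrow> nat \<Rightarrow> 'a" where
  "Sym3 F k1 k2 k3 =
     F k1 k2 k3 + F k1 k3 k2 + F k2 k1 k3 + F k2 k3 k1 + F k3 k1 k2 + F k3 k2 k1"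

definition Cyc3 :: "(nat \<Rightarrow> nat \<Rightarrow> nat \<Rightarrow> 'a::ring) \<Rightarrow> nat \<Rightarrow> nat \<Rightarrow> nat \<Rightarrow> 'a" where
  "Cyc3 F k1 k2 k3 = F k1 k2 k3 + F k2 k3 k1 + F k3 k1 k2"

text \<open>Right-hand side of the Serre relation for \<open>c\<^sub>i\<^sub>j = -1\<close>.\<close>

definition serre1_rhs :: "('i \<Rightarrow> nat) \<Rightarrow> 'i \<Rightarrow> 'i \<Rightarrow> nat \<Rightarrow> nat \<Rightarrow> nat \<Rightarrow> 'i yfree" where
  "serre1_rhs d i j r k1 k2 =
     (if even (k1 + k2)
      then [:(- 1) ^ (k1 + 1):] \<cdot>
        (monom (2 * (of_nat (d i) / 2) ^ (k1 + k2)) (k1 + k2) \<cdot> b_gen j r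
         + (\<Sum>t<(k1 + k2) div 2.
              monom ((of_nat (d i) / 2) ^ (2 * t)) (2 * t)
                \<cdot> comm (b_gen j (r + 1)) (h_gen i (int (k1 + k2) - 2 * int t - 1)))
         + (\<Sum>t<(k1 + k2) div 2.
              monom ((of_nat (d i)) ^ (2 * t + 1) / 2 ^ (2 * t)) (2 * t + 1)
                \<cdot> acomm (h_gen i (int (k1 + k2) - 2 * int t - 1)) (b_gen j r)))
      else 0)"

text \<open>
  The terms \<open>T\<^bsub>s,p\<^esub>\<close> of the Serre relation for \<open>c\<^sub>i\<^sub>j = -2\<close>, as a function of \<open>k\<^sub>1\<close>,
  \<open>p\<close> and \<open>l = k\<^sub>2 + k\<^sub>3 - 2s - 1\<close>.
\<close>

definition serre2_T ::
    "('i \<Rightarrow> nat) \<Rightarrow> 'i \<Rightarrow> 'i \<Rightarrow> nat \<Rightarrow> nat \<Rightarrow> nat \<Rightarrow> int \<Rightarrow> 'i yfree" where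
  "serre2_T d i j r k1 p l =
       [:3:] \<cdot> comm (comm (b_gen i (k1 + 2 * p)) (b_gen j (r + 1))) (h_gen i l)
     + comm (comm (b_gen i (k1 + 2 * p + 1)) (b_gen j r)) (h_gen i l)
     + [:6:] \<cdot> comm (b_gen i (k1 + 2 * p)) (comm (b_gen j (r + 1)) (h_gen i l))
     + [:2:] \<cdot> comm (b_gen i (k1 + 2 * p + 1)) (comm (b_gen j r) (h_gen i l))
     + monom (3 * of_nat (d i)) 1 \<cdot> comm (acomm (b_gen i (k1 + 2 * p)) (h_gen i l)) (b_gen j r)
     + monom (9 * of_nat (d i)) 1 \<cdot> comm (b_gen i (k1 + 2 * p)) (acomm (h_gen i l) (b_gen j r))"

text \<open>
  The sum over all \<open>s \<ge> 0\<close> is cut off at \<open>s < k\<^sub>2 + k\<^sub>3\<close>: for \<open>s \<ge> k\<^sub>2 + k\<^sub>3\<close> the index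
  \<open>l\<close> is negative, so that \<open>h_gen i l = 0\<close> and \<open>serre2_T\<close> vanishes.
\<close>

definition serre2_rhs ::
    "('i \<Rightarrow> nat) \<Rightarrow> 'i \<Rightarrow> 'i \<Rightarrow> nat \<Rightarrow> nat \<Rightarrow> nat \<Rightarrow> nat \<Rightarrow> 'i yfree" where
  "serre2_rhs d i j r =
     Cyc3 (\<lambda>k1 k2 k3.
       (\<Sum>s<k2 + k3. \<Sum>p\<le>s.
          monom ((- 1) ^ (k3 + p + 1) * of_nat (s choose p) / 3 ^ (p + 1)) (2 * s - 2 * p)
            \<cdot> serre2_T d i j r k1 p (int (k2 + k3) - 2 * int s - 1))
       + [:8:] \<cdot>
         (if even (k2 + k3)
          then (\<Sum>p\<le>(k2 + k3) div 2.
                  monom ((- 1) ^ (k3 + p + 1) * of_nat (((k2 + k3) div 2) choose p) / 3 ^ p)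
                        (k2 + k3 - 2 * p)
                    \<cdot> comm (b_gen i (k1 + 2 * p)) (b_gen j r))
          else 0))"

definition current_serre_relators ::
    "('i::finite \<Rightarrow> 'i \<Rightarrow> int) \<Rightarrow> ('i \<Rightarrow> nat) \<Rightarrow> 'i yfree set" where
  "current_serre_relators c d =
     {comm (b_gen i s) (b_gen j r) | i j s r. c i j = 0}
   \<union> {Sym2 (\<lambda>k1 k2. comm (b_gen i k1) (comm (b_gen i k2) (b_gen j r))) k1 k2 - serre1_rhs d i j r k1 k2
      | i j r k1 k2. c i j = - 1}
   \<union> {Sym3 (\<lambda>k1 k2 k3. comm (b_gen i k1) (comm (b_gen i k2) (comm (b_gen i k3) (b_gen j r)))) k1 k2 k3
       - serre2_rhs d i j r k1 k2 k3
      | i j r k1 k2 k3. c i j = - 2}"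

definition G2_serre_relators :: "('i::finite \<Rightarrow> 'i \<Rightarrow> int) \<Rightarrow> 'i yfree set" where
  "G2_serre_relators c =
     {comm (b_gen i 0) (comm (b_gen i 0) (b_gen j r)) - (- b_gen j r) | i j r. c i j = - 1}
   \<union> {comm (b_gen i 0) (comm (b_gen i 0) (comm (b_gen i 0) (comm (b_gen i 0) (b_gen j r))))
       - (- ([:10:] \<cdot> comm (b_gen i 0) (comm (b_gen i 0) (b_gen j r))) - [:9:] \<cdot> b_gen j r)
      | i j r. c i j = - 3}"

definition twisted_yangian ::
    "('i::finite \<Rightarrow> 'i \<Rightarrow> int) \<Rightarrow> ('i \<Rightarrow> nat) \<Rightarrow> (complex poly, 'i yfree set) module" where
  "twisted_yangian c d =
     presented_algebra (common_relators c d \<union>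
       (if type_G2 c then G2_serre_relators c else current_serre_relators c d))"

definition reduced_twisted_yangian ::
    "('i::finite \<Rightarrow> 'i \<Rightarrow> int) \<Rightarrow> ('i \<Rightarrow> nat) \<Rightarrow> (complex poly, 'i yfree set) module" where
  "reduced_twisted_yangian c d =
     presented_algebra (common_relators c d \<union> finite_serre_relators c)"

end

theory Submission
  imports Defs
begin

text \<open>
  Both algebras are quotients of the same free algebra, and the two ideals are equal. The Serre
  relations at index 0 are instances of the current ones. Conversely, suitable combinations of
  \<open>h\<^bsub>i,1\<^esub>\<close> and \<open>h\<^bsub>j,1\<^esub>\<close> shift the indices of \<open>b\<^sub>i\<close> alone, or of \<open>b\<^sub>j\<close> alone. They commute with
  all \<open>h\<close>. The current Serre elements for \<open>(i, j)\<close> form a symmetric family in the indices of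
  \<open>b\<^sub>i\<close>. If \<open>c\<^sub>i\<^sub>j = -1\<close>, then the shift determines the action of the first elementary symmetric
  polynomial on this family, and relation (4) determines the action of the second one. If
  \<open>c\<^sub>i\<^sub>j = -2\<close>, then the power sums of degree 1 and 3 act through \<open>h\<^bsub>i,1\<^esub>, h\<^bsub>j,1\<^esub>, h\<^bsub>i,3\<^esub>, h\<^bsub>j,3\<^esub>\<close>, and
  relation (4) yields the power sum of degree 2. The right-hand sides satisfy the same recursions,
  so the relations follow by induction on the total degree. In type \<open>G\<^sub>2\<close> only the shifts are needed.
\<close>

section \<open>A ring containing all quotients of a ring\<close>

text \<open>An index at one node can be raised alone only because the matrix with rows (2, c_ij) and
  (c_ji, 2) is invertible, so the bound c_ij c_ji < 4 of finite type enters already there. Three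
  symmetrised indices call for three symmetric functions. Degrees 1 and 3 come from commutators with
  h_{i,1} and h_{i,3}; as h_{i,2} = 0, degree 2 has to be extracted from relation (4), which is the
  purpose of the large word identity. Relation (4) for equal nodes controls
  \<open>BB k l + BB l k\<close> but not \<open>BB k l\<close>, so the identity is useful only after
  summation over all orders of the indices. The relation for c_ij = -2 contains bare powers of hbar
  where hbar d_i would be expected, so it has the right shape only for d_i = 1. This is a global
  property of the matrix: it follows from coprimality of d once a second double bond is excluded.
  Likewise an entry -3 has to force type G_2. Both facts use positive definiteness beyond rank
  two.\<close>

definition two_sided_ideal :: "'a::ring_1 set \<Rightarrow> bool" where
  "two_sided_ideal I \<longleftrightarrow>
     0 \<in> I \<and> (\<forall>x\<in>I. \<forall>y\<in>I. x + y \<in> I) \<and> (\<forall>a. \<forall>x\<in>I. a * x \<in> I \<and> x * a \<in> I)"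

context
  fixes I :: "'a::ring_1 set"
  assumes I: "two_sided_ideal I"
begin

lemma two_sided_ideal_zero: "0 \<in> I"
  and two_sided_ideal_add: "x \<in> I \<Longrightarrow> y \<in> I \<Longrightarrow> x + y \<in> I"
  and two_sided_ideal_mult: "x \<in> I \<Longrightarrow> a * x \<in> I" "x \<in> I \<Longrightarrow> x * a \<in> I"
  using I by (auto simp: two_sided_ideal_def)

lemma two_sided_ideal_uminus: "x \<in> I \<Longrightarrow> - x \<in> I"
  using two_sided_ideal_mult(1)[of x "- 1"] by simp

end

text \<open>
  The quotient by an ideal that is not a constant is not a type. All quotients of a ring
  \<open>A\<close> are therefore collected in one ring type, the product of \<open>A / I\<close> over all ideals \<open>I\<close>. A quotient
  \<open>A / J\<close> is the image of the non-unital homomorphism \<open>class_at J\<close>.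
\<close>

quotient_type (overloaded) 'a quotient_product = "'a::ring_1 set \<Rightarrow> 'a" /
  "\<lambda>f g. \<forall>I. two_sided_ideal I \<longrightarrow> f I - g I \<in> I"
proof (rule equivpI)
  show "reflp (\<lambda>f g :: 'a set \<Rightarrow> 'a. \<forall>I. two_sided_ideal I \<longrightarrow> f I - g I \<in> I)"
    by (auto simp: reflp_def intro: two_sided_ideal_zero)
  show "symp (\<lambda>f g :: 'a set \<Rightarrow> 'a. \<forall>I. two_sided_ideal I \<longrightarrow> f I - g I \<in> I)"
  proof (rule sympI, intro allI impI)
    fix f g :: "'a set \<Rightarrow> 'a" and I :: "'a set"
    assume "\<forall>I. two_sided_ideal I \<longrightarrow> f I - g I \<in> I" and I: "two_sided_ideal I"
    then have "- (f I - g I) \<in> I"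
      by (blast intro: two_sided_ideal_uminus)
    then show "g I - f I \<in> I" by simp
  qed
  show "transp (\<lambda>f g :: 'a set \<Rightarrow> 'a. \<forall>I. two_sided_ideal I \<longrightarrow> f I - g I \<in> I)"
  proof (rule transpI, intro allI impI)
    fix f g h :: "'a set \<Rightarrow> 'a" and I :: "'a set"
    assume "\<forall>I. two_sided_ideal I \<longrightarrow> f I - g I \<in> I" "\<forall>I. two_sided_ideal I \<longrightarrow> g I - h I \<in> I"
      and I: "two_sided_ideal I"
    then have "(f I - g I) + (g I - h I) \<in> I"
      by (blast intro: two_sided_ideal_add)
    then show "f I - h I \<in> I" by simp
  qed
qed

instantiation quotient_product :: (ring_1) ring_1
begin

lift_definition zero_quotient_product :: "'a quotient_product" is "\<lambda>I. 0" .

lift_definition one_quotient_product :: "'a quotient_product" is "\<lambda>I. 1" .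

lift_definition plus_quotient_product ::
    "'a quotient_product \<Rightarrow> 'a quotient_product \<Rightarrow> 'a quotient_product"
  is "\<lambda>f g I. f I + g I"
  by (simp add: add_diff_add two_sided_ideal_add)

lift_definition uminus_quotient_product :: "'a quotient_product \<Rightarrow> 'a quotient_product"
  is "\<lambda>f I. - f I"
  by (simp only: minus_diff_minus two_sided_ideal_uminus)

definition minus_quotient_product ::
    "'a quotient_product \<Rightarrow> 'a quotient_product \<Rightarrow> 'a quotient_product"
  where "minus_quotient_product x y = x + - y"

lift_definition times_quotient_product ::
    "'a quotient_product \<Rightarrow> 'a quotient_product \<Rightarrow> 'a quotient_product"
  is "\<lambda>f g I. f I * g I"
proof -
  fix f f' g g' :: "'a set \<Rightarrow> 'a" and I :: "'a set"
  assume "\<And>I. two_sided_ideal I \<Longrightarrow> f I - f' I \<in> I" "\<And>I. two_sided_ideal I \<Longrightarrow> g I - g' I \<in> I"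
    and I: "two_sided_ideal I"
  then have "f I * (g I - g' I) + (f I - f' I) * g' I \<in> I"
    by (blast intro: two_sided_ideal_add two_sided_ideal_mult)
  then show "f I * g I - f' I * g' I \<in> I" by (simp add: algebra_simps)
qed

lemmas quotient_product_abs_eq =
  plus_quotient_product.abs_eq uminus_quotient_product.abs_eq times_quotient_product.abs_eq

instance
proof
  fix u v w :: "'a quotient_product"
  have ex: "\<exists>f. z = abs_quotient_product f" for z :: "'a quotient_product"
    by (induction z rule: quotient_product.abs_induct) (rule exI, rule refl)
  obtain f where [simp]: "u = abs_quotient_product f" using ex by (rule exE)
  obtain g where [simp]: "v = abs_quotient_product g" using ex by (rule exE)
  obtain h where [simp]: "w = abs_quotient_product h" using ex by (rule exE)
  show "u - v = u + - v" by (fact minus_quotient_product_def)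
  show "u + v + w = u + (v + w)" by (simp add: quotient_product_abs_eq add.assoc)
  show "u + v = v + u" by (simp add: quotient_product_abs_eq add.commute)
  show "0 + u = u" by (simp add: zero_quotient_product_def quotient_product_abs_eq)
  show "- u + u = 0" by (simp add: zero_quotient_product_def quotient_product_abs_eq)
  show "u * v * w = u * (v * w)" by (simp add: quotient_product_abs_eq mult.assoc)
  show "1 * u = u" "u * 1 = u" by (simp_all add: one_quotient_product_def quotient_product_abs_eq)
  show "(u + v) * w = u * w + v * w" by (simp add: quotient_product_abs_eq distrib_right)
  show "u * (v + w) = u * v + u * w" by (simp add: quotient_product_abs_eq distrib_left)
  show "(0 :: 'a quotient_product) \<noteq> 1"
  proof
    assume "(0 :: 'a quotient_product) = 1"
    then have "\<forall>I. two_sided_ideal I \<longrightarrow> (0 :: 'a) - 1 \<in> I"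
      unfolding zero_quotient_product_def one_quotient_product_def quotient_product.abs_eq_iff .
    \<comment> \<open>The class \<open>ring_1\<close> demands \<open>0 \<noteq> 1\<close>. The
      coordinate at the zero ideal guarantees it, even if the ideal of interest is the whole
      ring.\<close>
    moreover have "two_sided_ideal {0 :: 'a}" by (simp add: two_sided_ideal_def)
    ultimately have "(0 :: 'a) - 1 \<in> {0}" by blast
    then show False by simp
  qed
qed

end

text \<open>The map \<open>class_at J\<close> sees only the coordinate \<open>J\<close>, so for an
  ideal its kernel is exactly \<open>J\<close>, but it sends 1 to an idempotent. Scalars must
  include the 1 of the product and therefore act through the diagonal; the third equation of
  \<open>class_at_simps\<close> links the two maps.\<close>

definition const_class :: "'a::ring_1 \<Rightarrow> 'a quotient_product" where
  "const_class a = abs_quotient_product (\<lambda>I. a)"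

definition class_at :: "'a::ring_1 set \<Rightarrow> 'a \<Rightarrow> 'a quotient_product" where
  "class_at J a = abs_quotient_product (\<lambda>I. if I = J then a else 0)"

lemma const_class_simps:
  "const_class 1 = 1" "const_class (a + b) = const_class a + const_class b"
  "const_class (a * b) = const_class a * const_class b"
  by (simp_all add: const_class_def plus_quotient_product.abs_eq times_quotient_product.abs_eq
      one_quotient_product_def)

lemma const_class_central:
  assumes "\<And>b. a * b = b * a"
  shows "const_class a * u = u * const_class a"
  unfolding const_class_def
  by (induction u rule: quotient_product.abs_induct)
    (simp add: times_quotient_product.abs_eq assms)

lemma class_at_simps:
  "class_at J (a + b) = class_at J a + class_at J b"
  "class_at J (a * b) = class_at J a * class_at J b"
  "class_at J (a * b) = const_class a * class_at J b"
  by (auto simp: class_at_def const_class_def plus_quotient_product.abs_eq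
      times_quotient_product.abs_eq intro!: arg_cong[where f = abs_quotient_product])

lemma class_at_eq_0_iff:
  assumes "two_sided_ideal J"
  shows "class_at J a = 0 \<longleftrightarrow> a \<in> J"
  using assms
  by (auto simp: class_at_def zero_quotient_product_def quotient_product.abs_eq_iff two_sided_ideal_zero)

section \<open>Scalars and generated ideals in the free algebra\<close>

lemma scal_hom:
  "scal 1 = 1" "scal (p + q) = scal p + scal q" "scal (p * q) = scal p * scal q"
  by (simp_all add: scal_def single_add mult_single)

lemma scal_central: "scal p * a = a * scal p" for a :: "'x free_alg"
proof (induction a rule: update_induct)
  case const
  then show ?case by simp
next
  case (update f w q)
  have "Poly_Mapping.update w q f = Poly_Mapping.single w q + f"
    using update.hyps by (intro poly_mapping_eqI) (auto simp: lookup_update lookup_add lookup_single in_keys_iff)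
  then show ?case using update by (simp add: scal_def distrib_left distrib_right mult_single mult.commute)
qed

lemma ring_free_algebra: "ring (free_algebra :: (complex poly, 'x free_alg) module)"
proof (rule ringI)
  show "abelian_group (free_algebra :: (complex poly, 'x free_alg) module)"
  proof (rule abelian_groupI)
    fix x assume "x \<in> carrier (free_algebra :: (complex poly, 'x free_alg) module)"
    show "\<exists>y\<in>carrier free_algebra. y \<oplus>\<^bsub>free_algebra\<^esub> x = \<zero>\<^bsub>free_algebra\<^esub>"
      by (rule bexI[of _ "- x"]) (simp_all add: free_algebra_def)
  qed (simp_all add: free_algebra_def ac_simps)
  show "Group.monoid (free_algebra :: (complex poly, 'x free_alg) module)"
    by (rule monoidI) (auto simp: free_algebra_def mult.assoc)
qed (simp_all add: free_algebra_def distrib_left distrib_right)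

lemma two_sided_ideal_genideal: "two_sided_ideal (genideal free_algebra R)"
proof -
  interpret ring "free_algebra :: (complex poly, 'a free_alg) module" by (rule ring_free_algebra)
  interpret I: ideal "genideal free_algebra R" "free_algebra :: (complex poly, 'a free_alg) module"
    by (rule genideal_ideal) (simp add: free_algebra_def)
  show ?thesis
    using I.zero_closed I.a_closed I.I_l_closed I.I_r_closed
    by (auto simp: two_sided_ideal_def free_algebra_def)
qed

lemma genideal_free_algebra_superset: "R \<subseteq> genideal free_algebra R"
  by (auto simp: genideal_def)

lemma genideal_free_algebra_minimal:
  assumes "R \<subseteq> genideal free_algebra R'"
  shows "genideal free_algebra R \<subseteq> genideal free_algebra R'"
proof -
  interpret ring "free_algebra :: (complex poly, 'a free_alg) module" by (rule ring_free_algebra)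
  have "ideal (genideal free_algebra R') (free_algebra :: (complex poly, 'a free_alg) module)"
    by (rule genideal_ideal) (simp add: free_algebra_def)
  then show ?thesis by (rule genideal_minimal) (fact assms)
qed

lemma algebra_isomorphic_refl: "algebra_isomorphic A A"
  unfolding algebra_isomorphic_def
  by (rule bexI[of _ id]) (auto simp: ring_iso_def ring_hom_def bij_betw_def)

section \<open>Linear identities over the integers in noncommutative rings\<close>

text \<open>
  The simplifier collects integer multiples of the same term only in commutative rings. An integral
  linear identity in a ring \<open>R\<close> is therefore proved in the commutative ring \<open>\<int> \<oplus> R\<close> in which
  \<open>R\<close> has square zero.
\<close>

datatype 'a null_extension = Null_ext int 'a

instantiation null_extension :: (ring_1) comm_ring_1
begin

definition "0 = Null_ext 0 0"

definition "1 = Null_ext 1 0"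

fun plus_null_extension where
  "Null_ext m x + Null_ext n y = Null_ext (m + n) (x + y)"

fun minus_null_extension where
  "Null_ext m x - Null_ext n y = Null_ext (m - n) (x - y)"

fun uminus_null_extension where
  "- Null_ext m x = Null_ext (- m) (- x)"

fun times_null_extension where
  "Null_ext m x * Null_ext n y = Null_ext (m * n) (of_int m * y + of_int n * x)"

instance
proof
  fix u v w :: "'a null_extension"
  note defs = zero_null_extension_def one_null_extension_def
  have of_int_of_int: "of_int m * (of_int n * x) = of_int (m * n) * x" for m n and x :: 'a
    by (simp add: mult.assoc)
  show "u + v + w = u + (v + w)" by (cases u; cases v; cases w) simp
  show "u + v = v + u" by (cases u; cases v) simp
  show "0 + u = u" by (cases u) (simp add: defs)
  show "- u + u = 0" by (cases u) (simp add: defs)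
  show "u - v = u + - v" by (cases u; cases v) simp
  show "u * v * w = u * (v * w)"
    by (cases u; cases v; cases w) (simp add: distrib_left of_int_of_int ac_simps del: of_int_mult)
  show "u * v = v * u" by (cases u; cases v) (simp add: algebra_simps)
  show "1 * u = u" by (cases u) (simp add: defs)
  show "(u + v) * w = u * w + v * w" by (cases u; cases v; cases w) (simp add: algebra_simps)
  show "(0 :: 'a null_extension) \<noteq> 1" by (simp add: defs)
qed

end

abbreviation null_elem :: "'a::ring_1 \<Rightarrow> 'a null_extension" where
  "null_elem \<equiv> Null_ext 0"

lemma null_elem_numeral: "null_elem (numeral n * x) = numeral n * null_elem x"
proof -
  have "of_nat k = (Null_ext (int k) 0 :: 'a null_extension)" for k
    by (induction k) (simp_all add: zero_null_extension_def one_null_extension_def)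
  from this[of "numeral n"] have "(numeral n :: 'a null_extension) = Null_ext (numeral n) 0"
    unfolding of_nat_numeral .
  show ?thesis unfolding \<open>numeral n = Null_ext (numeral n) 0\<close> by simp
qed

lemma null_elem_hom:
  "null_elem 0 = 0" "null_elem (x + y) = null_elem x + null_elem y"
  "null_elem (x - y) = null_elem x - null_elem y" "null_elem (- x) = - null_elem x"
  by (simp_all add: zero_null_extension_def)

lemma null_elem_inject: "null_elem x = null_elem y \<Longrightarrow> x = y"
  by simp

text \<open>Left in the simpset, these equations would merge the images of separate monomials into
  one constructor term again.\<close>

declare plus_null_extension.simps [simp del] minus_null_extension.simps [simp del]
  uminus_null_extension.simps [simp del] times_null_extension.simps [simp del]

lemma numeral_commute: "y * numeral n = numeral n * y" for y :: "'a::ring_1"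
  using mult_of_nat_commute[of "numeral n" y] by simp

lemma numeral_left_commute: "y * (numeral n * z) = numeral n * (y * z)" for y z :: "'a::ring_1"
proof -
  have "y * numeral n * z = numeral n * y * z" by (simp only: numeral_commute[of y])
  then show ?thesis by (simp only: mult.assoc)
qed

text \<open>Only sums and numerals pass through \<open>null_elem\<close>; a product of ring elements
  stays inside as an atom. After \<open>null_elem_inject\<close> and this expansion, both sides are
  numeral combinations of atoms in a commutative ring, where \<open>algebra_simps\<close> can
  collect them.\<close>

lemmas null_elem_expand =
  distrib_left distrib_right left_diff_distrib right_diff_distrib mult.assoc add.assoc
  null_elem_hom null_elem_numeral nat_1_add_1 mult_minus_left mult_minus_right

section \<open>Commutators and central scalars\<close>

lemma comm_linear:
  fixes x y z :: "'a::ring"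
  shows "comm z (x + y) = comm z x + comm z y" "comm z (x - y) = comm z x - comm z y"
    "comm z (- x) = - comm z x" "comm z 0 = 0"
    "comm (x + y) z = comm x z + comm y z" "comm (x - y) z = comm x z - comm y z"
    "comm (- x) z = - comm x z" "comm 0 z = 0"
  by (simp_all add: comm_def algebra_simps)

lemma acomm_linear:
  fixes x y z :: "'a::ring"
  shows "acomm z (x + y) = acomm z x + acomm z y" "acomm z (x - y) = acomm z x - acomm z y"
    "acomm z (- x) = - acomm z x" "acomm z 0 = 0"
    "acomm (x + y) z = acomm x z + acomm y z" "acomm (x - y) z = acomm x z - acomm y z"
    "acomm (- x) z = - acomm x z" "acomm 0 z = 0"
  by (simp_all add: acomm_def algebra_simps)

lemma comm_derivation:
  fixes x y z :: "'a::ring"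
  shows "comm z (comm x y) = comm (comm z x) y + comm x (comm z y)"
    "comm z (acomm x y) = acomm (comm z x) y + acomm x (comm z y)"
  by (simp_all add: comm_def acomm_def algebra_simps)

lemma comm_sum: "comm z (sum f A) = (\<Sum>a\<in>A. comm z (f a))" for z :: "'a::ring"
  by (simp add: comm_def sum_distrib_left sum_distrib_right sum_subtractf)

lemma comm_swap: "comm x y = - comm y x" for x y :: "'a::ring"
  by (simp add: comm_def)

lemma acomm_swap: "acomm x y = acomm y x" for x y :: "'a::ring"
  by (simp add: acomm_def add.commute)

lemma comm_mult_left: "comm (x * y) z = x * comm y z + comm x z * y" for x y z :: "'a::ring"
  by (simp add: comm_def algebra_simps)

locale central_scalars =
  fixes sc :: "complex poly \<Rightarrow> 'a::ring_1"
  assumes sc_1: "sc 1 = 1"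
    and sc_add: "sc (p + q) = sc p + sc q"
    and sc_mult: "sc (p * q) = sc p * sc q"
    and sc_central: "sc p * y = y * sc p"
begin

lemma sc_0: "sc 0 = 0"
  using sc_add[of 0 0] by simp

lemma sc_uminus: "sc (- p) = - sc p"
  using sc_add[of "- p" p] by (simp add: sc_0 eq_neg_iff_add_eq_0)

lemma sc_diff: "sc (p - q) = sc p - sc q"
  using sc_add[of p "- q"] by (simp add: sc_uminus)

lemma sc_of_nat: "sc (of_nat n) = of_nat n"
  by (induction n) (simp_all add: sc_0 sc_1 sc_add)

lemma sc_numeral: "sc (numeral n) = numeral n"
  using sc_of_nat[of "numeral n"] by simp

lemma sc_power: "sc (p ^ n) = sc p ^ n"
  by (induction n) (simp_all add: sc_1 sc_mult)

lemma comm_sc: "comm z (sc p * y) = sc p * comm z y" "comm (sc p * z) y = sc p * comm z y"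
proof -
  have "z * (sc p * y) = sc p * (z * y)" for z y by (metis sc_central mult.assoc)
  then show "comm z (sc p * y) = sc p * comm z y" "comm (sc p * z) y = sc p * comm z y"
    by (simp_all add: comm_def right_diff_distrib mult.assoc)
qed

lemma acomm_sc: "acomm z (sc p * y) = sc p * acomm z y" "acomm (sc p * z) y = sc p * acomm z y"
proof -
  have "z * (sc p * y) = sc p * (z * y)" for z y by (metis sc_central mult.assoc)
  then show "acomm z (sc p * y) = sc p * acomm z y" "acomm (sc p * z) y = sc p * acomm z y"
    by (simp_all add: acomm_def distrib_left mult.assoc)
qed

lemma comm_numeral:
  "comm z (numeral n * y) = numeral n * comm z (y :: 'a)"
  "comm (numeral n * z) y = numeral n * comm z (y :: 'a)"
  by (simp_all add: comm_sc flip: sc_numeral)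

lemma comm_sign:
  "comm z ((- 1) ^ k * y) = (- 1) ^ k * comm z (y :: 'a)"
  "comm ((- 1) ^ k * z) y = (- 1) ^ k * comm z (y :: 'a)"
  by (simp_all add: minus_one_power_iff comm_linear)

lemma sc_sign: "sc [:(- 1) ^ k:] = (- 1) ^ k"
proof -
  have one: "[:1:] = (1 :: complex poly)" "[:- 1:] = - (1 :: complex poly)"
    by (simp_all add: one_pCons)
  show ?thesis
    by (cases "even k") (simp_all only: minus_one_power_iff if_True if_False one sc_uminus sc_1)
qed

lemma comm_sc_left: "comm (sc p) z = 0"
  by (simp only: comm_def sc_central[of p z] diff_self)

lemma sc_const_numeral: "sc [:numeral n:] = numeral n"
  using sc_numeral[of n] by (simp add: numeral_poly)

text \<open>A \<open>ring_1\<close> may have torsion, but here the inverse of a numeral is a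
  constant polynomial and acts through \<open>sc\<close>.\<close>

lemma numeral_mult_cancel:
  assumes "numeral n * x = numeral n * (y :: 'a)"
  shows "x = y"
proof -
  have "[:1 / numeral n:] * numeral n = (1 :: complex poly)"
    by (simp add: numeral_poly one_pCons)
  then have "sc [:1 / numeral n:] * numeral n = 1"
    using sc_mult[of "[:1 / numeral n:]" "numeral n"] unfolding sc_numeral by (simp add: sc_1)
  then show ?thesis using assms by (metis mult.assoc mult_1_left)
qed

end

section \<open>Raising one index by a commutator\<close>

locale shift_pair = central_scalars sc for sc :: "complex poly \<Rightarrow> 'a::ring_1" +
  fixes b x :: "nat \<Rightarrow> 'a" and zb zx :: 'a
  assumes zb_b: "comm zb (b k) = b (Suc k)" and zb_x: "comm zb (x r) = 0"
    and zx_b: "comm zx (b k) = 0" and zx_x: "comm zx (x r) = x (Suc r)"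
begin

lemma serre_0_shift:
  assumes "comm (b 0) (x 0) = 0"
  shows "comm (b k) (x r) = 0"
proof (induction k)
  case 0
  show ?case
  proof (induction r)
    case (Suc r)
    then have "comm zx (comm (b 0) (x r)) = 0" by (simp add: comm_linear)
    then show ?case by (simp add: comm_derivation[of zx] zx_b zx_x comm_linear)
  qed (fact assms)
next
  case (Suc k)
  then have "comm zb (comm (b k) (x r)) = 0" by (simp add: comm_linear)
  then show ?case by (simp add: comm_derivation[of zb] zb_b zb_x comm_linear)
qed

text \<open>The derivation \<open>comm zx\<close> kills \<open>b 0\<close>, so it acts only on the
  innermost entry and raises \<open>r\<close>. This and the next two lemmas start the inductions on
  the degree or, in type G_2, give the complete family.\<close>

lemma serre_1_shift:
  assumes "comm (b 0) (comm (b 0) (x 0)) = - x 0"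
  shows "comm (b 0) (comm (b 0) (x r)) = - x r"
proof (induction r)
  case (Suc r)
  then have "comm zx (comm (b 0) (comm (b 0) (x r))) = comm zx (- x r)" by simp
  then show ?case by (simp add: comm_derivation[of zx] zx_b zx_x comm_linear)
qed (fact assms)

lemma serre_2_shift:
  assumes "comm (b 0) (comm (b 0) (comm (b 0) (x 0))) = - (4 * comm (b 0) (x 0))"
  shows "comm (b 0) (comm (b 0) (comm (b 0) (x r))) = - (4 * comm (b 0) (x r))"
proof (induction r)
  case (Suc r)
  then have "comm zx (comm (b 0) (comm (b 0) (comm (b 0) (x r)))) = comm zx (- (4 * comm (b 0) (x r)))"
    by simp
  then show ?case by (simp add: comm_derivation[of zx] zx_b zx_x comm_linear comm_numeral)
qed (fact assms)

lemma serre_3_shift: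
  assumes "comm (b 0) (comm (b 0) (comm (b 0) (comm (b 0) (x 0)))) =
    - (10 * comm (b 0) (comm (b 0) (x 0))) - 9 * x 0"
  shows "comm (b 0) (comm (b 0) (comm (b 0) (comm (b 0) (x r)))) =
    - (10 * comm (b 0) (comm (b 0) (x r))) - 9 * x r"
proof (induction r)
  case (Suc r)
  then have "comm zx (comm (b 0) (comm (b 0) (comm (b 0) (comm (b 0) (x r))))) =
      comm zx (- (10 * comm (b 0) (comm (b 0) (x r))) - 9 * x r)"
    by simp
  then show ?case by (simp add: comm_derivation[of zx] zx_b zx_x comm_linear comm_numeral)
qed (fact assms)

end

section \<open>Serre relations\<close>

text \<open>
  In the two identities below, \<open>BX = 0\<close> is relation (4) for two different nodes, and
  \<open>BB k l + BB l k\<close> is the left-hand side of relation (4) for two equal nodes. The sum of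
  \<open>W\<close> over all permutations of the indices of \<open>b\<close> is the Serre element. The coefficients
  are the solution of a linear system.
\<close>

lemma serre_1_word_identity:
  fixes hb :: "'a::ring_1" and b x :: "nat \<Rightarrow> 'a"
  assumes b: "\<And>k. b k * hb = hb * b k" and x: "\<And>k. x k * hb = hb * x k"
    and W: "W = (\<lambda>k l r. b k * b l * x r - 2 * (b k * x r * b l) + x r * b k * b l)"
    and BX: "BX = (\<lambda>k r. comm (b k) (x (r + 1)) - comm (b (k + 1)) (x r) - hb * acomm (b k) (x r))"
    and BB: "BB = (\<lambda>k l. b k * b (l + 1) - b (k + 1) * b l + 2 * (hb * b k * b l))"
  shows
    "2 * W (k + 1) (l + 1) r + 2 * (hb * (hb * W k l r)) - W (k + 1) l (r + 1) - W k (l + 1) (r + 1) =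
     - 2 * (b (k + 1) * BX l r) + 2 * (hb * (b k * BX l r)) + 2 * (BX k r * b (l + 1)) + 2 * (hb * (BX k r * b l))
     - BB k l * x (r + 1) + 2 * (hb * (BB k l * x r)) + x (r + 1) * BB k l + 2 * (hb * (x r * BB k l))"
proof -
  have central: "b k * (hb * z) = hb * (b k * z)" "x k * (hb * z) = hb * (x k * z)" for k z
    by (metis b x mult.assoc)+
  note numerals = numeral_left_commute[of "b k" for k] numeral_left_commute[of "x k" for k] numeral_left_commute[of hb]
    numeral_commute[of "b k" for k] numeral_commute[of "x k" for k]
  show ?thesis
    unfolding W BX BB comm_def acomm_def
    by (rule null_elem_inject)
      (simp only: null_elem_expand b x central numerals; simp add: algebra_simps)
qed

lemma serre_2_word_identity:
  fixes hb :: "'a::ring_1" and b x :: "nat \<Rightarrow> 'a"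
  assumes b: "\<And>k. b k * hb = hb * b k" and x: "\<And>k. x k * hb = hb * x k"
    and W: "W = (\<lambda>k l m r. b k * b l * b m * x r - 3 * (b k * b l * x r * b m)
      + 3 * (b k * x r * b l * b m) - x r * b k * b l * b m)"
    and BX: "BX = (\<lambda>k r. comm (b k) (x (r + 1)) - comm (b (k + 1)) (x r) - hb * acomm (b k) (x r))"
    and BB: "BB = (\<lambda>k l. b k * b (l + 1) - b (k + 1) * b l + hb * b k * b l)"
  shows
    "2 * (W (k + 2) l m r + W k (l + 2) m r + W k l (m + 2) r)
       - 2 * (W (k + 1) (l + 1) m r + W (k + 1) l (m + 1) r + W k (l + 1) (m + 1) r)
       - 6 * (hb * (hb * W k l m r)) =
     3 * (b (k + 1) * b l * BX m r)
     + 3 * (b k * b (l + 1) * BX m r)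
     - 6 * (b k * b l * BX (m + 1) r)
     - 9 * hb * (b k * b l * BX m r)
     - 6 * (b (k + 1) * BX l r * b m)
     + 12 * (b k * BX (l + 1) r * b m)
     - 6 * (b k * BX l r * b (m + 1))
     - 6 * (BX (k + 1) r * b l * b m)
     + 3 * (BX k r * b (l + 1) * b m)
     + 3 * (BX k r * b l * b (m + 1))
     + 9 * hb * (BX k r * b l * b m)
     - 2 * (BB (k + 1) l * b m * x r)
     - 2 * (BB k (l + 1) * b m * x r)
     + (BB k l * b (m + 1) * x r)
     + 3 * (BB k l * b m * x (r + 1))
     - 3 * hb * (BB k l * b m * x r)
     - 4 * (b k * BB (l + 1) m * x r)
     - 4 * (b k * BB l (m + 1) * x r)
     + 2 * (b (k + 1) * BB l m * x r)
     + 6 * (b k * BB l m * x (r + 1))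
     - 12 * hb * (b k * BB l m * x r)
     + 6 * (BB (k + 1) l * x r * b m)
     + 6 * (BB k (l + 1) * x r * b m)
     - 3 * (BB k l * x r * b (m + 1))
     - 9 * (BB k l * x (r + 1) * b m)
     + 9 * hb * (BB k l * x r * b m)
     + 6 * (b k * x r * BB (l + 1) m)
     + 6 * (b k * x r * BB l (m + 1))
     - 3 * (b (k + 1) * x r * BB l m)
     - 9 * (b k * x (r + 1) * BB l m)
     - 9 * hb * (b k * x r * BB l m)
     - 4 * (x r * BB (k + 1) l * b m)
     - 4 * (x r * BB k (l + 1) * b m)
     + 2 * (x r * BB k l * b (m + 1))
     + 6 * (x (r + 1) * BB k l * b m)
     + 12 * hb * (x r * BB k l * b m)
     - 2 * (x r * b k * BB (l + 1) m)
     - 2 * (x r * b k * BB l (m + 1))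
     + (x r * b (k + 1) * BB l m)
     + 3 * (x (r + 1) * b k * BB l m)
     + 3 * hb * (x r * b k * BB l m)"
proof -
  have central: "b k * (hb * z) = hb * (b k * z)" "x k * (hb * z) = hb * (x k * z)" for k z
    by (metis b x mult.assoc)+
  note numerals = numeral_left_commute[of "b k" for k] numeral_left_commute[of "x k" for k] numeral_left_commute[of hb]
    numeral_commute[of "b k" for k] numeral_commute[of "x k" for k]
  show ?thesis
    unfolding W BX BB comm_def acomm_def
    by (rule null_elem_inject)
      (simp only: null_elem_expand b x central numerals; simp add: algebra_simps)
qed

locale serre_pair = shift_pair sc b x zb zx
  for sc :: "complex poly \<Rightarrow> 'a::ring_1" and b x zb zx +
  fixes h :: "nat \<Rightarrow> 'a"
  assumes zb_h: "comm zb (h l) = 0"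
    and h_even: "even l \<Longrightarrow> h l = 0"
begin

text \<open>Half of the right-hand side of relation (4) for equal nodes.\<close>

definition signed_h :: "nat \<Rightarrow> nat \<Rightarrow> 'a" where
  "signed_h k l = (- 1) ^ k * h (k + l + 1)"

text \<open>If \<open>k + l\<close> is even, the two signs agree; if it is odd, \<open>h\<close> is
  taken at an even index and vanishes.\<close>

lemma signed_h_sym: "signed_h k l = signed_h l k"
proof (cases "even (k + l)")
  case True
  then show ?thesis by (auto simp: signed_h_def minus_one_power_iff add.commute)
qed (simp add: signed_h_def h_even)

lemma signed_h_Suc: "signed_h (Suc k) l = - signed_h k (Suc l)"
  by (simp add: signed_h_def)

end

section \<open>The Serre relations for c_ij = -1, with \<theta> = hbar d_i / 2\<close>

locale serre_pair_1 = serre_pair +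
  fixes \<theta> :: "complex poly"
  assumes bx: "comm (b k) (x (Suc r)) - comm (b (Suc k)) (x r) = sc \<theta> * acomm (b k) (x r)"
    and bb: "comm (b k) (b (Suc l)) - comm (b (Suc k)) (b l) + 2 * (sc \<theta> * acomm (b l) (b k))
      = 2 * ((- 1) ^ k * h (k + l + 1))"
begin

definition serre :: "nat \<Rightarrow> nat \<Rightarrow> nat \<Rightarrow> 'a" where
  "serre k l r = Sym2 (\<lambda>k l. comm (b k) (comm (b l) (x r))) k l"

text \<open>The bracket on the right of the Serre relation at k_1 + k_2 = 2n. In terms of \<theta>
  the coefficient 2^(-2t) (hbar d_i)^(2t+1) becomes 2 \<theta>^(2t+1).\<close>

definition even_value :: "nat \<Rightarrow> nat \<Rightarrow> 'a" where
  "even_value n r =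
     2 * (sc \<theta> ^ (2 * n) * x r)
     + (\<Sum>t<n. sc \<theta> ^ (2 * t) * comm (x (Suc r)) (h (2 * n - 2 * t - 1)))
     + (\<Sum>t<n. 2 * (sc \<theta> ^ (2 * t + 1) * acomm (h (2 * n - 2 * t - 1)) (x r)))"

definition serre_value :: "nat \<Rightarrow> nat \<Rightarrow> nat \<Rightarrow> 'a" where
  "serre_value k l r =
     (if even (k + l) then (- 1) ^ (k + 1) * even_value ((k + l) div 2) r else 0)"

lemma serre_sym: "serre k l r = serre l k r"
  by (simp add: serre_def Sym2_def add.commute)

lemma serre_shift: "serre (Suc k) l r + serre k (Suc l) r = comm zb (serre k l r)"
  by (simp add: serre_def Sym2_def comm_linear comm_derivation[of zb] zb_b zb_x)

text \<open>Raising both \<open>k\<close> and \<open>l\<close> is the second elementary symmetric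
  polynomial in the index shifts; the terms at \<open>Suc r\<close> carry the first one. The proof
  sums \<open>serre_1_word_identity\<close> over the two orders of \<open>k\<close> and
  \<open>l\<close>, with the \<open>BX\<close> terms zero.\<close>

lemma serre_recursion:
  "2 * serre (Suc k) (Suc l) r + 2 * (sc \<theta> * (sc \<theta> * serre k l r))
     - serre (Suc k) l (Suc r) - serre k (Suc l) (Suc r) =
   - 2 * comm (signed_h k l) (x (Suc r)) + 4 * (sc \<theta> * acomm (signed_h k l) (x r))"
proof -
  define W where "W = (\<lambda>k l r. b k * b l * x r - 2 * (b k * x r * b l) + x r * b k * b l)"
  define BB where "BB = (\<lambda>k l. b k * b (l + 1) - b (k + 1) * b l + 2 * (sc \<theta> * b k * b l))"
  have serre_W: "serre k l r = W k l r + W l k r" for k l r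
    unfolding serre_def Sym2_def comm_def W_def
    by (rule null_elem_inject) (simp only: null_elem_expand; simp add: algebra_simps)
  have BB_sum: "BB k l + BB l k = 2 * signed_h k l" for k l
    using bb[of k l] by (simp add: BB_def signed_h_def comm_def acomm_def algebra_simps)
  define BX where "BX = (\<lambda>k r. comm (b k) (x (r + 1)) - comm (b (k + 1)) (x r) - sc \<theta> * acomm (b k) (x r))"
  have BX_0: "BX k r = 0" for k r
    using bx[of k r] by (simp add: BX_def)
  have W_BB: "2 * W (k + 1) (l + 1) r + 2 * (sc \<theta> * (sc \<theta> * W k l r))
      - W (k + 1) l (r + 1) - W k (l + 1) (r + 1) =
     - (BB k l * x (r + 1)) + 2 * (sc \<theta> * (BB k l * x r))
      + x (r + 1) * BB k l + 2 * (sc \<theta> * (x r * BB k l))" for k l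
    using serre_1_word_identity[OF sc_central[symmetric] sc_central[symmetric] W_def BX_def BB_def, of k l r]
    unfolding BX_0 by simp
  have "2 * serre (Suc k) (Suc l) r + 2 * (sc \<theta> * (sc \<theta> * serre k l r))
     - serre (Suc k) l (Suc r) - serre k (Suc l) (Suc r) =
    (2 * W (k + 1) (l + 1) r + 2 * (sc \<theta> * (sc \<theta> * W k l r)) - W (k + 1) l (r + 1) - W k (l + 1) (r + 1))
     + (2 * W (l + 1) (k + 1) r + 2 * (sc \<theta> * (sc \<theta> * W l k r)) - W (l + 1) k (r + 1) - W l (k + 1) (r + 1))"
    unfolding serre_W
    by (rule null_elem_inject) (simp only: null_elem_expand; simp add: algebra_simps)
  \<comment> \<open>Every \<open>BB k l\<close> now meets a \<open>BB l k\<close> in the same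
    position, so the value of the sum, \<open>BB_sum\<close>, suffices.\<close>
  also have "\<dots> = - ((BB k l + BB l k) * x (r + 1)) + 2 * (sc \<theta> * ((BB k l + BB l k) * x r))
      + x (r + 1) * (BB k l + BB l k) + 2 * (sc \<theta> * (x r * (BB k l + BB l k)))"
    unfolding W_BB by (rule null_elem_inject) (simp only: null_elem_expand; simp add: algebra_simps)
  also have "\<dots> = - 2 * comm (signed_h k l) (x (Suc r)) + 4 * (sc \<theta> * acomm (signed_h k l) (x r))"
    unfolding BB_sum comm_def acomm_def
    by (rule null_elem_inject)
      (simp only: null_elem_expand numeral_left_commute[of "x k" for k] numeral_left_commute[of "sc p" for p];
        simp add: algebra_simps)
  finally show ?thesis .
qed

text \<open>The summands at \<open>t = 0\<close> are the new terms; all others carry two additional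
  factors \<theta> and form the previous value.\<close>

lemma even_value_Suc:
  "even_value (Suc n) r = sc \<theta> * (sc \<theta> * even_value n r)
     - comm (h (Suc (2 * n))) (x (Suc r)) + 2 * (sc \<theta> * acomm (h (Suc (2 * n))) (x r))"
proof -
  have "(\<Sum>t<Suc n. sc \<theta> ^ (2 * t) * comm (x (Suc r)) (h (2 * Suc n - 2 * t - 1))) =
      comm (x (Suc r)) (h (2 * n + 1))
      + sc \<theta> * (sc \<theta> * (\<Sum>t<n. sc \<theta> ^ (2 * t) * comm (x (Suc r)) (h (2 * n - 2 * t - 1))))"
    by (simp add: sum.lessThan_Suc_shift sum_distrib_left mult.assoc del: sum.lessThan_Suc)
  moreover have "(\<Sum>t<Suc n. 2 * (sc \<theta> ^ (2 * t + 1) * acomm (h (2 * Suc n - 2 * t - 1)) (x r))) =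
      2 * (sc \<theta> * acomm (h (2 * n + 1)) (x r))
      + sc \<theta> * (sc \<theta> * (\<Sum>t<n. 2 * (sc \<theta> ^ (2 * t + 1) * acomm (h (2 * n - 2 * t - 1)) (x r))))"
    by (simp add: sum.lessThan_Suc_shift sum_distrib_left mult.assoc numeral_left_commute[of "sc p" for p]
        del: sum.lessThan_Suc)
  ultimately show ?thesis
    by (simp add: even_value_def comm_swap[of "h (Suc l)" for l] distrib_left mult.assoc
        numeral_left_commute[of "sc p" for p] del: sum.lessThan_Suc)
qed

lemma serre_value_shift: "serre_value (Suc k) l r = - serre_value k (Suc l) r"
  by (simp add: serre_value_def)

lemma serre_value_sym: "serre_value k l r = serre_value l k r"
  by (auto simp: serre_value_def minus_one_power_iff add.commute)

text \<open>This is half of \<open>serre_recursion\<close>. The two terms at \<open>Suc r\<close>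
  are absent because they cancel for the value by \<open>serre_value_shift\<close>.\<close>

lemma serre_value_Suc_Suc:
  "serre_value (Suc k) (Suc l) r = - (sc \<theta> * (sc \<theta> * serre_value k l r))
     - comm (signed_h k l) (x (Suc r)) + 2 * (sc \<theta> * acomm (signed_h k l) (x r))"
proof (cases "even (k + l)")
  case True
  then have "2 * ((k + l) div 2) = k + l" by simp
  then show ?thesis
    using True even_value_Suc[of "(k + l) div 2" r]
    by (auto simp: serre_value_def signed_h_def minus_one_power_iff comm_linear acomm_linear)
qed (simp add: serre_value_def signed_h_def h_even comm_linear acomm_linear)

lemma comm_zb_serre_value: "comm zb (serre_value k l r) = 0"
  by (simp add: serre_value_def even_value_def comm_linear comm_sum comm_sign comm_numeral comm_sc
      comm_derivation[of zb] acomm_linear zb_x zb_h flip: sc_power sc_mult)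

theorem serre_eq_value:
  assumes "comm (b 0) (comm (b 0) (x 0)) = - x 0"
  shows "serre k l r = serre_value k l r"
proof (induction "k + l" arbitrary: k l r rule: less_induct)
  case less
  have shift: "serre (Suc i) j s + serre i (Suc j) s = 0" if "i + j < k + l" for i j s
    using serre_shift[of i j s] less[of i j s] that by (simp add: comm_zb_serre_value)
  have inner: "serre (Suc i) (Suc j) r = serre_value (Suc i) (Suc j) r" if "Suc (Suc (i + j)) = k + l" for i j
  proof -
    \<comment> \<open>The terms at \<open>Suc r\<close> have degree one less than
      \<open>k + l\<close>. They are the shift of the pair \<open>(i, j)\<close>, which vanishes by
      the induction hypothesis; hence \<open>r\<close> has to be arbitrary in the induction.\<close>
    have "serre (Suc i) j (Suc r) + serre i (Suc j) (Suc r) = 0" "serre i j r = serre_value i j r"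
      using that by (auto intro: shift less)
    then have "2 * serre (Suc i) (Suc j) r = 2 * serre_value (Suc i) (Suc j) r"
      using serre_recursion[of i j r]
      by (simp add: serre_value_Suc_Suc eq_neg_iff_add_eq_0 algebra_simps)
    then show ?thesis by (rule numeral_mult_cancel)
  qed
  have outer: "serre (Suc i) 0 r = serre_value (Suc i) 0 r" if "Suc i = k + l" for i
  proof -
    \<comment> \<open>The shift trades the index 0 for 1 at the cost of a sign. Then both indices
      are positive, except in degree 1, where symmetry turns the shift into
      \<open>2 * serre = 0\<close>.\<close>
    have *: "serre (Suc i) 0 r = - serre i (Suc 0) r"
      using shift[of i 0 r] that by (simp add: eq_neg_iff_add_eq_0)
    show ?thesis
    proof (cases i)
      case 0
      have "serre (Suc 0) 0 r + serre 0 (Suc 0) r = 0"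
        using that by (intro shift) linarith
      then have "2 * serre (Suc 0) 0 r = 2 * 0"
        unfolding serre_sym[of 0 "Suc 0" r] by (simp add: mult_2)
      then have "serre (Suc 0) 0 r = 0" by (rule numeral_mult_cancel)
      then show ?thesis using 0 by (simp add: serre_value_def)
    next
      case (Suc j)
      have "serre (Suc j) (Suc 0) r = serre_value (Suc j) (Suc 0) r"
        using Suc that by (intro inner) linarith
      then show ?thesis using * Suc by (simp only: serre_value_shift)
    qed
  qed
  consider "k = 0" "l = 0" | i where "k = Suc i" "l = 0" | j where "k = 0" "l = Suc j"
    | i j where "k = Suc i" "l = Suc j"
    by (cases k; cases l) auto
  then show ?case
  proof cases
    case 1
    then show ?thesis
      using serre_1_shift[OF assms, of r]
      by (simp add: serre_def Sym2_def serre_value_def even_value_def mult_2)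
  next
    case 2
    then show ?thesis using outer by simp
  next
    case 3
    then show ?thesis using outer[of j] serre_sym serre_value_sym by simp
  next
    case 4
    then show ?thesis using inner by simp
  qed
qed

end

section \<open>The Serre relations for c_ij = -2, with \<theta> = hbar\<close>

locale serre_pair_2 = serre_pair +
  fixes \<theta> :: "complex poly" and z3 :: 'a
  assumes bx: "comm (b k) (x (Suc r)) - comm (b (Suc k)) (x r) = sc \<theta> * acomm (b k) (x r)"
    and bb: "comm (b k) (b (Suc l)) - comm (b (Suc k)) (b l) + sc \<theta> * acomm (b l) (b k)
      = 2 * ((- 1) ^ k * h (k + l + 1))"
    and z3_b: "comm z3 (b k) = b (k + 3)" and z3_x: "comm z3 (x r) = 0" and z3_h: "comm z3 (h l) = 0"
begin

definition serre :: "nat \<Rightarrow> nat \<Rightarrow> nat \<Rightarrow> nat \<Rightarrow> 'a" where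
  "serre k l m r = Sym3 (\<lambda>k l m. comm (b k) (comm (b l) (comm (b m) (x r)))) k l m"

text \<open>The term T_{s,p} of the Serre relation with k = k_1 + 2p. The factor h_{i,l} is replaced
  by a variable \<open>y\<close>, so that linearity can be stated and \<open>signed_h\<close>
  inserted.\<close>

definition T :: "nat \<Rightarrow> nat \<Rightarrow> 'a \<Rightarrow> 'a" where
  "T r k y =
     3 * comm (comm (b k) (x (Suc r))) y + comm (comm (b (Suc k)) (x r)) y
     + 6 * comm (b k) (comm (x (Suc r)) y) + 2 * comm (b (Suc k)) (comm (x r) y)
     + 3 * (sc \<theta> * comm (acomm (b k) y) (x r)) + 9 * (sc \<theta> * comm (b k) (acomm y (x r)))"

lemma T_linear: "T r k 0 = 0" "T r k (- y) = - T r k y" "T r k ((- 1) ^ n * y) = (- 1) ^ n * T r k y"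
  by (simp_all add: T_def comm_linear acomm_linear minus_one_power_iff)

lemma comm_T:
  assumes "\<And>k. comm z (b k) = b (k + n)" "\<And>r. comm z (x r) = 0" "comm z y = 0"
  shows "comm z (T r k y) = T r (k + n) y"
  using assms
  by (simp add: T_def comm_linear acomm_linear comm_derivation[of z] comm_numeral comm_sc)

text \<open>In terms of index shifts, the left-hand side is 2 p_2 - 2 e_2 - 6 \<theta>^2 applied to
  \<open>serre\<close>, where p_2 is the power sum and e_2 the elementary symmetric polynomial. The
  right-hand side comes from \<open>serre_2_word_identity\<close>, summed over the six orders of the
  indices.\<close>

lemma serre_recursion:
  "2 * (serre (k + 2) l m r + serre k (l + 2) m r + serre k l (m + 2) r)
   - 2 * (serre (k + 1) (l + 1) m r + serre (k + 1) l (m + 1) r + serre k (l + 1) (m + 1) r)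
   - 6 * (sc \<theta> * (sc \<theta> * serre k l m r)) =
   - (2 * (T r k (signed_h l m) + T r l (signed_h m k) + T r m (signed_h k l)))"
proof -
  define W where "W = (\<lambda>k l m r. b k * b l * b m * x r - 3 * (b k * b l * x r * b m)
      + 3 * (b k * x r * b l * b m) - x r * b k * b l * b m)"
  define BX where "BX = (\<lambda>k r. comm (b k) (x (r + 1)) - comm (b (k + 1)) (x r) - sc \<theta> * acomm (b k) (x r))"
  define BB where "BB = (\<lambda>k l. b k * b (l + 1) - b (k + 1) * b l + sc \<theta> * b k * b l)"
  define V where "V = (\<lambda>k l m. 2 * (W (k + 2) l m r + W k (l + 2) m r + W k l (m + 2) r)
       - 2 * (W (k + 1) (l + 1) m r + W (k + 1) l (m + 1) r + W k (l + 1) (m + 1) r)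
       - 6 * (sc \<theta> * (sc \<theta> * W k l m r)))"
  \<comment> \<open>\<open>Y1\<close> collects the terms in which \<open>BB\<close> replaces the
    first two factors \<open>b\<close>, and \<open>Y2\<close> those in which it replaces the last
    two. They are symmetrised in different pairs of indices.\<close>
  define Y1 where "Y1 = (\<lambda>k l m. - 2 * (BB (k + 1) l * b m * x r)
     - 2 * (BB k (l + 1) * b m * x r)
     + (BB k l * b (m + 1) * x r)
     + 3 * (BB k l * b m * x (r + 1))
     - 3 * sc \<theta> * (BB k l * b m * x r)
     + 6 * (BB (k + 1) l * x r * b m)
     + 6 * (BB k (l + 1) * x r * b m)
     - 3 * (BB k l * x r * b (m + 1))
     - 9 * (BB k l * x (r + 1) * b m)
     + 9 * sc \<theta> * (BB k l * x r * b m)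
     - 4 * (x r * BB (k + 1) l * b m)
     - 4 * (x r * BB k (l + 1) * b m)
     + 2 * (x r * BB k l * b (m + 1))
     + 6 * (x (r + 1) * BB k l * b m)
     + 12 * sc \<theta> * (x r * BB k l * b m))"
  define Y2 where "Y2 = (\<lambda>k l m. - 4 * (b k * BB (l + 1) m * x r)
     - 4 * (b k * BB l (m + 1) * x r)
     + 2 * (b (k + 1) * BB l m * x r)
     + 6 * (b k * BB l m * x (r + 1))
     - 12 * sc \<theta> * (b k * BB l m * x r)
     + 6 * (b k * x r * BB (l + 1) m)
     + 6 * (b k * x r * BB l (m + 1))
     - 3 * (b (k + 1) * x r * BB l m)
     - 9 * (b k * x (r + 1) * BB l m)
     - 9 * sc \<theta> * (b k * x r * BB l m)
     - 2 * (x r * b k * BB (l + 1) m)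
     - 2 * (x r * b k * BB l (m + 1))
     + (x r * b (k + 1) * BB l m)
     + 3 * (x (r + 1) * b k * BB l m)
     + 3 * sc \<theta> * (x r * b k * BB l m))"
  note numerals = numeral_left_commute[of "b k" for k] numeral_left_commute[of "x k" for k]
    numeral_left_commute[of "sc p" for p] numeral_left_commute[of "signed_h k l" for k l]
  have central: "b k * sc p = sc p * b k" "x k * sc p = sc p * x k"
    "signed_h k l * sc p = sc p * signed_h k l" for k l p
    by (rule sc_central[symmetric])+
  have central': "b k * (sc p * z) = sc p * (b k * z)" "x k * (sc p * z) = sc p * (x k * z)"
    "signed_h k l * (sc p * z) = sc p * (signed_h k l * z)" for k l p z
    by (simp_all only: central flip: mult.assoc)
  have serre_W: "serre k l m r = W k l m r + W k m l r + W l k m r + W l m k r + W m k l r + W m l k r" for k l m r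
    unfolding serre_def Sym3_def comm_def W_def
    by (rule null_elem_inject) (simp only: null_elem_expand numerals; simp add: algebra_simps)
  have BB_sum: "BB k l + BB l k = 2 * signed_h k l" for k l
    using bb[of k l] by (simp add: BB_def signed_h_def comm_def acomm_def algebra_simps)
  \<comment> \<open>Raising one index or the other gives opposite values of \<open>signed_h\<close>,
    so all terms with a raised index inside \<open>BB\<close> drop out.\<close>
  have BB_shift_sum: "BB (k + 1) l + BB l (k + 1) + (BB (l + 1) k + BB k (l + 1)) = 0" for k l
    using signed_h_Suc[of k l] signed_h_sym[of k "Suc l"] by (simp add: BB_sum)
  have BX_0: "BX k r = 0" for k r
    using bx[of k r] by (simp add: BX_def)
  have V: "V k l m = Y1 k l m + Y2 k l m" for k l m
    using serre_2_word_identity[OF sc_central[symmetric] sc_central[symmetric] W_def BX_def BB_def, of k l m r]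
    unfolding BX_0 V_def Y1_def Y2_def by (simp add: algebra_simps)
  have Y1: "Y1 k l m + Y1 l k m =
     - 2 * ((BB (k + 1) l + BB l (k + 1) + (BB (l + 1) k + BB k (l + 1))) * b m * x r)
     + ((BB k l + BB l k) * b (m + 1) * x r)
     + 3 * ((BB k l + BB l k) * b m * x (r + 1))
     - 3 * sc \<theta> * ((BB k l + BB l k) * b m * x r)
     + 6 * ((BB (k + 1) l + BB l (k + 1) + (BB (l + 1) k + BB k (l + 1))) * x r * b m)
     - 3 * ((BB k l + BB l k) * x r * b (m + 1))
     - 9 * ((BB k l + BB l k) * x (r + 1) * b m)
     + 9 * sc \<theta> * ((BB k l + BB l k) * x r * b m)
     - 4 * (x r * (BB (k + 1) l + BB l (k + 1) + (BB (l + 1) k + BB k (l + 1))) * b m)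
     + 2 * (x r * (BB k l + BB l k) * b (m + 1))
     + 6 * (x (r + 1) * (BB k l + BB l k) * b m)
     + 12 * sc \<theta> * (x r * (BB k l + BB l k) * b m)" for k l m
    unfolding Y1_def by (rule null_elem_inject) (simp only: null_elem_expand; simp add: algebra_simps)
  have Y2: "Y2 k l m + Y2 k m l =
     - 4 * (b k * (BB (l + 1) m + BB m (l + 1) + (BB (m + 1) l + BB l (m + 1))) * x r)
     + 2 * (b (k + 1) * (BB l m + BB m l) * x r)
     + 6 * (b k * (BB l m + BB m l) * x (r + 1))
     - 12 * sc \<theta> * (b k * (BB l m + BB m l) * x r)
     + 6 * (b k * x r * (BB (l + 1) m + BB m (l + 1) + (BB (m + 1) l + BB l (m + 1))))
     - 3 * (b (k + 1) * x r * (BB l m + BB m l))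
     - 9 * (b k * x (r + 1) * (BB l m + BB m l))
     - 9 * sc \<theta> * (b k * x r * (BB l m + BB m l))
     - 2 * (x r * b k * (BB (l + 1) m + BB m (l + 1) + (BB (m + 1) l + BB l (m + 1))))
     + (x r * b (k + 1) * (BB l m + BB m l))
     + 3 * (x (r + 1) * b k * (BB l m + BB m l))
     + 3 * sc \<theta> * (x r * b k * (BB l m + BB m l))" for k l m
    unfolding Y2_def by (rule null_elem_inject) (simp only: null_elem_expand; simp add: algebra_simps)
  \<comment> \<open>Here \<open>m\<close> is the index outside \<open>BB\<close> in all four terms;
    each of the three choices of that index yields one \<open>T\<close>.\<close>
  have T: "Y1 k l m + Y1 l k m + (Y2 m k l + Y2 m l k) = - (2 * T r m (signed_h k l))" for k l m
    unfolding Y1 Y2 unfolding BB_shift_sum unfolding BB_sum T_def comm_def acomm_def mult_zero_left mult_zero_right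
    by (rule null_elem_inject)
      (simp only: null_elem_expand numerals central central'; simp add: algebra_simps)
  have "2 * (serre (k + 2) l m r + serre k (l + 2) m r + serre k l (m + 2) r)
      - 2 * (serre (k + 1) (l + 1) m r + serre (k + 1) l (m + 1) r + serre k (l + 1) (m + 1) r)
      - 6 * (sc \<theta> * (sc \<theta> * serre k l m r)) =
    V k l m + V k m l + V l k m + V l m k + V m k l + V m l k"
    unfolding serre_W V_def
    by (rule null_elem_inject) (simp only: null_elem_expand; simp add: algebra_simps)
  also have "\<dots> = (Y1 l m k + Y1 m l k + (Y2 k l m + Y2 k m l))
      + (Y1 m k l + Y1 k m l + (Y2 l m k + Y2 l k m)) + (Y1 k l m + Y1 l k m + (Y2 m k l + Y2 m l k))"
    unfolding V by (simp add: algebra_simps)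
  also have "\<dots> = - (2 * (T r k (signed_h l m) + T r l (signed_h m k) + T r m (signed_h k l)))"
    unfolding T by (simp add: algebra_simps)
  finally show ?thesis .
qed

text \<open>The n-th power of the operator \<theta>^2 - S^2 / 3, where S raises the index by 1. Its
  binomial expansion is the inner sum over p in the Serre relation.\<close>

primrec iterate_sq :: "nat \<Rightarrow> (nat \<Rightarrow> 'a) \<Rightarrow> nat \<Rightarrow> 'a" where
  "iterate_sq 0 f k = f k"
| "iterate_sq (Suc n) f k = sc \<theta> * (sc \<theta> * iterate_sq n f k) - sc [:1 / 3:] * iterate_sq n f (k + 2)"

lemma comm_iterate_sq:
  assumes "\<And>k. comm z (f k) = f (k + d)"
  shows "comm z (iterate_sq n f k) = iterate_sq n f (k + d)"
proof (induction n arbitrary: k)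
  case (Suc n)
  show ?case by (simp add: comm_linear comm_sc Suc.IH add.commute add.left_commute)
qed (simp add: assms)

lemma iterate_sq_eq_sum:
  "iterate_sq n f k =
     (\<Sum>p\<le>n. sc ([:(- 1) ^ p * of_nat (n choose p) / 3 ^ p:] * \<theta> ^ (2 * n - 2 * p)) * f (k + 2 * p))"
proof (induction n arbitrary: k)
  case 0
  show ?case by (simp add: sc_1 flip: one_pCons)
next
  case (Suc n)
  define q where "q = (\<lambda>n p. [:(- 1) ^ p * of_nat (n choose p) / 3 ^ p:] * \<theta> ^ (2 * n - 2 * p))"
  have q_Suc_0: "q (Suc n) 0 = \<theta> * (\<theta> * q n 0)"
    by (simp add: q_def)
  have q_Suc_Suc: "q (Suc n) (Suc p) = \<theta> * (\<theta> * q n (Suc p)) - [:1 / 3:] * q n p" for p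
  proof -
    have "\<theta> * (\<theta> * q n (Suc p)) = [:(- 1) ^ Suc p * of_nat (n choose Suc p) / 3 ^ Suc p:] * \<theta> ^ (2 * n - 2 * p)"
    \<comment> \<open>For \<open>p \<ge> n\<close> the exponent \<open>2 * n - 2 * Suc p\<close> is
      truncated, but then the binomial coefficient is zero.\<close>
    proof (cases "p < n")
      case True
      then have "2 * n - 2 * p = Suc (Suc (2 * n - 2 * Suc p))" by simp
      then show ?thesis by (simp add: q_def del: mult_Suc_right)
    qed (simp add: q_def binomial_eq_0)
    moreover have "[:1 / 3:] * q n p = [:(- 1) ^ p * of_nat (n choose p) / 3 ^ Suc p:] * \<theta> ^ (2 * n - 2 * p)"
      by (simp add: q_def mult.commute)
    moreover have "q (Suc n) (Suc p) =
        ([:(- 1) ^ Suc p * of_nat (n choose Suc p) / 3 ^ Suc p:] - [:(- 1) ^ p * of_nat (n choose p) / 3 ^ Suc p:])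
          * \<theta> ^ (2 * n - 2 * p)"
    proof -
      have "(- 1) ^ Suc p * of_nat (Suc n choose Suc p) / 3 ^ Suc p =
          (- 1) ^ Suc p * of_nat (n choose Suc p) / 3 ^ Suc p - (- 1) ^ p * of_nat (n choose p) / (3 ^ Suc p :: complex)"
        unfolding diff_divide_distrib[symmetric] by (simp add: algebra_simps)
      then show ?thesis by (simp only: q_def diff_pCons diff_0_right mult_Suc_right diff_add_inverse diff_cancel2 diff_diff_cancel add_diff_cancel_left)
    qed
    ultimately show ?thesis by (simp only: left_diff_distrib)
  qed
  have IH: "iterate_sq n f k = (\<Sum>p\<le>n. sc (q n p) * f (k + 2 * p))" for k
    unfolding q_def by (rule Suc.IH)
  \<comment> \<open>The extra summand has coefficient zero. It makes the first sum, after splitting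
    off \<open>p = 0\<close>, range over the same indices as the shifted second one, as Pascal's
    rule requires.\<close>
  have "iterate_sq n f k = (\<Sum>p\<le>Suc n. sc (q n p) * f (k + 2 * p))"
    unfolding IH by (simp add: q_def sc_0 binomial_eq_0)
  also have "\<dots> = sc (q n 0) * f k + (\<Sum>p\<le>n. sc (q n (Suc p)) * f (k + 2 * Suc p))"
    by (subst sum.atMost_Suc_shift) simp
  finally have "iterate_sq (Suc n) f k = sc (q (Suc n) 0) * f k
      + (\<Sum>p\<le>n. sc (q (Suc n) (Suc p)) * f (k + 2 * Suc p))"
    by (simp only: iterate_sq.simps IH[of "k + 2"] q_Suc_0 q_Suc_Suc sc_mult sc_diff mult.assoc distrib_left
        left_diff_distrib sum_subtractf sum_distrib_left) (simp add: algebra_simps)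
  also have "\<dots> = (\<Sum>p\<le>Suc n. sc (q (Suc n) p) * f (k + 2 * p))"
    by (subst sum.atMost_Suc_shift) simp
  finally show ?case by (simp only: q_def)
qed

text \<open>One term of the cyclic sum at k_1 = k and k_2 + k_3 = 2n, without the sign (-1)^(k_3).
  The factor 1/3 remains from 3^(-p-1), since \<open>iterate_sq\<close> absorbs 3^(-p).\<close>

definition even_value :: "nat \<Rightarrow> nat \<Rightarrow> nat \<Rightarrow> 'a" where
  "even_value r n k =
     - (sc [:1 / 3:] * (\<Sum>s<n. iterate_sq s (\<lambda>k. T r k (h (2 * n - 2 * s - 1))) k))
     - 8 * iterate_sq n (\<lambda>k. comm (b k) (x r)) k"

text \<open>The summand \<open>s = 0\<close> is new; every other part of the value receives one more
  application of \<theta>^2 - S^2 / 3.\<close>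

lemma even_value_Suc:
  "even_value r (Suc n) k = sc \<theta> * (sc \<theta> * even_value r n k)
     - sc [:1 / 3:] * even_value r n (k + 2) - sc [:1 / 3:] * T r k (h (2 * n + 1))"
proof -
  have central: "sc \<theta> * (sc [:1 / 3:] * z) = sc [:1 / 3:] * (sc \<theta> * z)" for z
    by (metis sc_central mult.assoc)
  have "(\<Sum>s<Suc n. iterate_sq s (\<lambda>k. T r k (h (2 * Suc n - 2 * s - 1))) k) =
      T r k (h (2 * n + 1))
      + (sc \<theta> * (sc \<theta> * (\<Sum>s<n. iterate_sq s (\<lambda>k. T r k (h (2 * n - 2 * s - 1))) k))
        - sc [:1 / 3:] * (\<Sum>s<n. iterate_sq s (\<lambda>k. T r k (h (2 * n - 2 * s - 1))) (k + 2)))"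
    by (simp add: sum.lessThan_Suc_shift sum_distrib_left sum_subtractf del: sum.lessThan_Suc)
  then show ?thesis
    unfolding even_value_def iterate_sq.simps
    by (simp only:) (simp add: algebra_simps central numeral_left_commute[of "sc p" for p])
qed

lemma comm_even_value:
  assumes "\<And>k. comm z (b k) = b (k + d)" "\<And>r. comm z (x r) = 0" "\<And>l. comm z (h l) = 0"
  shows "comm z (even_value r n k) = even_value r n (k + d)"
proof -
  have "comm z (iterate_sq s (\<lambda>k. T r k (h l)) k) = iterate_sq s (\<lambda>k. T r k (h l)) (k + d)" for s l k
    by (rule comm_iterate_sq) (simp add: comm_T assms)
  moreover have "comm z (iterate_sq s (\<lambda>k. comm (b k) (x r)) k) = iterate_sq s (\<lambda>k. comm (b k) (x r)) (k + d)" for s k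
    by (rule comm_iterate_sq) (simp add: comm_derivation[of z] comm_linear assms)
  ultimately show ?thesis
    by (simp add: even_value_def comm_linear comm_sc comm_sum comm_numeral)
qed

definition summand :: "nat \<Rightarrow> nat \<Rightarrow> nat \<Rightarrow> nat \<Rightarrow> 'a" where
  "summand r k l m = (if even (l + m) then (- 1) ^ m * even_value r ((l + m) div 2) k else 0)"

definition serre_value :: "nat \<Rightarrow> nat \<Rightarrow> nat \<Rightarrow> nat \<Rightarrow> 'a" where
  "serre_value k l m r = Cyc3 (summand r) k l m"

lemma summand_sym: "summand r k l m = summand r k m l"
  by (auto simp: summand_def minus_one_power_iff add.commute)

lemma summand_Suc_Suc:
  "3 * summand r k l (Suc (Suc m)) = 3 * (sc \<theta> * (sc \<theta> * summand r k l m))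
     - summand r (k + 2) l m - T r k (signed_h l m)"
proof (cases "even (l + m)")
  case True
  then have n: "2 * ((l + m) div 2) = l + m" by simp
  have third: "3 * (sc [:1 / 3:] * z) = z" for z
  proof -
    have "sc 3 * (sc [:1 / 3:] * z) = sc (3 * [:1 / 3:]) * z" by (simp only: sc_mult mult.assoc)
    also have "(3 :: complex poly) * [:1 / 3:] = 1" by (simp add: numeral_poly one_pCons)
    finally show ?thesis by (simp add: sc_numeral sc_1)
  qed
  have "3 * even_value r (Suc ((l + m) div 2)) k = 3 * (sc \<theta> * (sc \<theta> * even_value r ((l + m) div 2) k))
     - even_value r ((l + m) div 2) (k + 2) - T r k (h (l + m + 1))"
    unfolding even_value_Suc n by (simp only: right_diff_distrib third)
  moreover have "(- 1) ^ l = ((- 1) ^ m :: 'a)"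
    using True by (auto simp: minus_one_power_iff)
  ultimately show ?thesis
    using True by (auto simp: summand_def signed_h_def T_linear minus_one_power_iff algebra_simps)
qed (simp add: summand_def signed_h_def h_even T_linear)

lemma comm_summand:
  assumes "\<And>k. comm z (b k) = b (k + d)" "\<And>r. comm z (x r) = 0" "\<And>l. comm z (h l) = 0"
  shows "comm z (summand r k l m) = summand r (k + d) l m"
  using comm_even_value[OF assms] by (simp add: summand_def comm_linear comm_sign)

lemma serre_shift:
  assumes "\<And>k. comm z (b k) = b (k + d)" "\<And>r. comm z (x r) = 0"
  shows "comm z (serre k l m r) = serre (k + d) l m r + serre k (l + d) m r + serre k l (m + d) r"
  using assms by (simp add: serre_def Sym3_def comm_linear comm_derivation[of z] algebra_simps)

text \<open>For odd \<open>d\<close>, raising \<open>l\<close> and raising \<open>m\<close> in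
  \<open>summand r k l m\<close> give opposite signs and cancel. Only the shift of the first
  argument survives, and this is what \<open>comm z\<close> does.\<close>

lemma serre_value_shift:
  assumes "\<And>k. comm z (b k) = b (k + d)" "\<And>r. comm z (x r) = 0" "\<And>l. comm z (h l) = 0"
    and "odd d"
  shows "comm z (serre_value k l m r) =
    serre_value (k + d) l m r + serre_value k (l + d) m r + serre_value k l (m + d) r"
proof -
  have "summand r k (l + d) m + summand r k l (m + d) = 0" for k l m
    using \<open>odd d\<close> by (auto simp: summand_def minus_one_power_iff ac_simps)
  then have "summand r k (l + d) m = - summand r k l (m + d)" for k l m
    by (simp add: eq_neg_iff_add_eq_0)
  then show ?thesis
    by (simp add: serre_value_def Cyc3_def comm_linear comm_summand[OF assms(1-3)])
qed

lemma zb_shift: "comm zb (b k) = b (k + 1)"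
  by (simp add: zb_b)

text \<open>From p_1^2 = p_2 + 2 e_2 follows 3 p_2 = p_1^2 + (2 p_2 - 2 e_2). The square of p_1 is
  \<open>comm zb\<close> twice, and \<open>serre_recursion\<close> evaluates the rest.\<close>

lemma serre_second_shift:
  "3 * (serre (k + 2) l m r + serre k (l + 2) m r + serre k l (m + 2) r) =
   comm zb (comm zb (serre k l m r)) + 6 * (sc \<theta> * (sc \<theta> * serre k l m r))
   - (2 * (T r k (signed_h l m) + T r l (signed_h m k) + T r m (signed_h k l)))"
proof -
  have "3 * (serre (k + 2) l m r + serre k (l + 2) m r + serre k l (m + 2) r) =
     ((serre (k + 2) l m r + serre k (l + 2) m r + serre k l (m + 2) r)
      + 2 * (serre (k + 1) (l + 1) m r + serre (k + 1) l (m + 1) r + serre k (l + 1) (m + 1) r))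
     + 6 * (sc \<theta> * (sc \<theta> * serre k l m r))
     + (2 * (serre (k + 2) l m r + serre k (l + 2) m r + serre k l (m + 2) r)
       - 2 * (serre (k + 1) (l + 1) m r + serre (k + 1) l (m + 1) r + serre k (l + 1) (m + 1) r)
       - 6 * (sc \<theta> * (sc \<theta> * serre k l m r)))"
    by (rule null_elem_inject) (simp only: null_elem_expand; simp add: algebra_simps)
  also have "(serre (k + 2) l m r + serre k (l + 2) m r + serre k l (m + 2) r)
      + 2 * (serre (k + 1) (l + 1) m r + serre (k + 1) l (m + 1) r + serre k (l + 1) (m + 1) r) =
      comm zb (comm zb (serre k l m r))"
    unfolding serre_shift[OF zb_shift zb_x] comm_linear
    by (rule null_elem_inject) (simp only: null_elem_expand; simp add: algebra_simps)
  finally show ?thesis unfolding serre_recursion by simp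
qed

text \<open>For each cyclic summand, raising the first argument by 2 contributes three copies, and
  the other two arguments remove one copy each by \<open>summand_Suc_Suc\<close>. The remaining copy
  is \<open>comm zb\<close> applied twice.\<close>

lemma serre_value_second_shift:
  "3 * (serre_value (k + 2) l m r + serre_value k (l + 2) m r + serre_value k l (m + 2) r) =
   comm zb (comm zb (serre_value k l m r)) + 6 * (sc \<theta> * (sc \<theta> * serre_value k l m r))
   - (2 * (T r k (signed_h l m) + T r l (signed_h m k) + T r m (signed_h k l)))"
proof -
  have shift: "3 * summand r k l (m + 2) = 3 * (sc \<theta> * (sc \<theta> * summand r k l m))
      - summand r (k + 2) l m - T r k (signed_h l m)"
    "3 * summand r k (l + 2) m = 3 * (sc \<theta> * (sc \<theta> * summand r k l m))
      - summand r (k + 2) l m - T r k (signed_h l m)" for k l m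
    using summand_Suc_Suc[of r k l m] summand_Suc_Suc[of r k m l]
    by (simp_all add: summand_sym[of r _ "Suc _"] summand_sym[of r _ m l] signed_h_sym[of m l])
  have zb: "comm zb (summand r k l m) = summand r (k + 1) l m" for k l m
    by (rule comm_summand[OF zb_shift zb_x zb_h])
  have "3 * (serre_value (k + 2) l m r + serre_value k (l + 2) m r + serre_value k l (m + 2) r) =
     3 * summand r (k + 2) l m + 3 * summand r (l + 2) m k + 3 * summand r (m + 2) k l
     + 3 * summand r k (l + 2) m + 3 * summand r k l (m + 2) + 3 * summand r l (m + 2) k
     + 3 * summand r l m (k + 2) + 3 * summand r m (k + 2) l + 3 * summand r m k (l + 2)"
    by (simp add: serre_value_def Cyc3_def algebra_simps)
  also have "\<dots> = comm zb (comm zb (serre_value k l m r)) + 6 * (sc \<theta> * (sc \<theta> * serre_value k l m r))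
   - (2 * (T r k (signed_h l m) + T r l (signed_h m k) + T r m (signed_h k l)))"
    unfolding shift serre_value_def Cyc3_def comm_linear zb
    by (rule null_elem_inject)
      (simp only: null_elem_expand numeral_left_commute[of "sc p" for p]; simp add: algebra_simps)
  finally show ?thesis .
qed

text \<open>
  The power sums of degrees 1, 2 and 3 generate the symmetric polynomials in three variables, so a
  symmetric family that they annihilate vanishes in positive degrees.
\<close>

lemma vanishing_by_power_sums:
  fixes E :: "nat \<Rightarrow> nat \<Rightarrow> nat \<Rightarrow> 'a"
  assumes sym: "\<And>k l m. E k l m = E l k m" "\<And>k l m. E k l m = E k m l"
    and base: "E 0 0 0 = 0"
    and p1: "\<And>k l m. E k l m = 0 \<Longrightarrow> E (k + 1) l m + E k (l + 1) m + E k l (m + 1) = 0"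
    and p2: "\<And>k l m. E k l m = 0 \<Longrightarrow> E (k + 2) l m + E k (l + 2) m + E k l (m + 2) = 0"
    and p3: "\<And>k l m. E k l m = 0 \<Longrightarrow> E (k + 3) l m + E k (l + 3) m + E k l (m + 3) = 0"
  shows "E k l m = 0"
proof (induction "k + l + m" arbitrary: k l m rule: less_induct)
  case less
  define n where "n = k + l + m"
  have IH: "E i j p = 0" if "i + j + p < n" for i j p
    using less that by (simp add: n_def)
  have P1: "E (Suc i) j p + E i (Suc j) p + E i j (Suc p) = 0" if "i + j + p + 1 = n" for i j p
    using p1[OF IH[of i j p]] that by simp
  have P2: "E (Suc (Suc i)) j p + E i (Suc (Suc j)) p + E i j (Suc (Suc p)) = 0" if "i + j + p + 2 = n" for i j p
    using p2[OF IH[of i j p]] that by simp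
  have P3: "E (Suc (Suc (Suc i))) j p + E i (Suc (Suc (Suc j))) p + E i j (Suc (Suc (Suc p))) = 0"
    if "i + j + p + 3 = n" for i j p
    using p3[OF IH[of i j p]] that by (simp add: numeral_3_eq_3)
  have e2: "E (Suc i) (Suc j) p + E (Suc i) j (Suc p) + E i (Suc j) (Suc p) = 0" if "i + j + p + 2 = n" for i j p
  proof -
    \<comment> \<open>Newton's identity 2 e_2 = p_1^2 - p_2.\<close>
    have "2 * (E (Suc i) (Suc j) p + E (Suc i) j (Suc p) + E i (Suc j) (Suc p)) =
      (E (Suc (Suc i)) j p + E (Suc i) (Suc j) p + E (Suc i) j (Suc p))
      + (E (Suc i) (Suc j) p + E i (Suc (Suc j)) p + E i (Suc j) (Suc p))
      + (E (Suc i) j (Suc p) + E i (Suc j) (Suc p) + E i j (Suc (Suc p)))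
      - (E (Suc (Suc i)) j p + E i (Suc (Suc j)) p + E i j (Suc (Suc p)))"
      by (simp add: mult_2 algebra_simps)
    also have "\<dots> = 2 * 0"
      using that P1[of "Suc i" j p] P1[of i "Suc j" p] P1[of i j "Suc p"] P2[of i j p] by simp
    finally show ?thesis by (rule numeral_mult_cancel)
  qed
  have e3: "E (Suc i) (Suc j) (Suc p) = 0" if "i + j + p + 3 = n" for i j p
  proof -
    \<comment> \<open>Newton's identity 3 e_3 = p_3 + e_2 p_1 - p_1 p_2.\<close>
    have "3 * E (Suc i) (Suc j) (Suc p) =
       (E (Suc (Suc (Suc i))) j p + E i (Suc (Suc (Suc j))) p + E i j (Suc (Suc (Suc p))))
       + (E (Suc (Suc i)) (Suc j) p + E (Suc (Suc i)) j (Suc p) + E (Suc i) (Suc j) (Suc p))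
       + (E (Suc i) (Suc (Suc j)) p + E (Suc i) (Suc j) (Suc p) + E i (Suc (Suc j)) (Suc p))
       + (E (Suc i) (Suc j) (Suc p) + E (Suc i) j (Suc (Suc p)) + E i (Suc j) (Suc (Suc p)))
       - (E (Suc (Suc (Suc i))) j p + E (Suc (Suc i)) (Suc j) p + E (Suc (Suc i)) j (Suc p))
       - (E (Suc i) (Suc (Suc j)) p + E i (Suc (Suc (Suc j))) p + E i (Suc (Suc j)) (Suc p))
       - (E (Suc i) j (Suc (Suc p)) + E i (Suc j) (Suc (Suc p)) + E i j (Suc (Suc (Suc p))))"
      by (rule null_elem_inject) (simp only: null_elem_expand; simp add: algebra_simps)
    also have "\<dots> = 3 * 0"
      using that P3[of i j p] e2[of "Suc i" j p] e2[of i "Suc j" p] e2[of i j "Suc p"]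
        P1[of "Suc (Suc i)" j p] P1[of i "Suc (Suc j)" p] P1[of i j "Suc (Suc p)"] by simp
    finally show ?thesis by (rule numeral_mult_cancel)
  qed
  have two: "E (Suc i) (Suc j) 0 = 0" if n: "i + j + 2 = n" for i j
  proof -
    \<comment> \<open>Of the three terms of \<open>e2\<close> at \<open>(i, j, 0)\<close>, those
      with three positive indices vanish by \<open>e3\<close>. The others coincide by symmetry, so
      one, two or three copies of the wanted term remain.\<close>
    consider i' j' where "i = Suc i'" "j = Suc j'" | j' where "i = 0" "j = Suc j'"
      | i' where "i = Suc i'" "j = 0" | "i = 0" "j = 0"
      by (cases i; cases j) auto
    then show ?thesis
    proof cases
      case (1 i' j')
      then show ?thesis
        using n e2[of i j 0] e3[of i j' 0] e3[of i' j 0] by simp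
    next
      case (2 j')
      have "2 * E (Suc 0) (Suc j) 0 = 2 * 0"
        using 2 n e2[of 0 j 0] e3[of 0 j' 0] sym(1)[of 0 "Suc j" 1] sym(2)[of "Suc j" 0 1] sym(1)[of "Suc j" 1 0]
        by (simp add: mult_2)
      then show ?thesis using 2 numeral_mult_cancel by blast
    next
      case (3 i')
      have "2 * E (Suc i) (Suc 0) 0 = 2 * 0"
        using 3 n e2[of i 0 0] e3[of i' 0 0] sym(2)[of "Suc i" 0 1] by (simp add: mult_2)
      then show ?thesis using 3 numeral_mult_cancel by blast
    next
      case 4
      have "3 * E 1 1 0 = E 1 1 0 + E 1 0 1 + E 0 1 1"
        unfolding sym(1)[of 0 1 1] sym(2)[of 1 0 1]
        by (rule null_elem_inject) (simp only: null_elem_expand; simp)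
      also have "\<dots> = 3 * 0" using 4 n e2[of 0 0 0] by simp
      finally show ?thesis using 4 numeral_mult_cancel[of _ "E 1 1 0" 0] by simp
    qed
  qed
  have one: "E n 0 0 = 0"
  proof (cases n)
    case 0
    then show ?thesis using base by simp
  next
    case (Suc i)
    show ?thesis
    proof (cases i)
      case 0
      have "3 * E 1 0 0 = E 1 0 0 + E 0 1 0 + E 0 0 1"
        unfolding sym(2)[of 0 0 1] sym(1)[of 0 1 0]
        by (rule null_elem_inject) (simp only: null_elem_expand; simp)
      also have "\<dots> = 3 * 0" using 0 Suc P1[of 0 0 0] by simp
      finally show ?thesis using 0 Suc numeral_mult_cancel[of _ "E 1 0 0" 0] by simp
    next
      case (Suc j)
      then show ?thesis
        using \<open>n = Suc i\<close> P1[of i 0 0] two[of j 0] sym(2)[of i 0 1] by simp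
    qed
  qed
  show ?case
  proof (cases "k = 0 \<or> l = 0 \<or> m = 0")
    case False
    then show ?thesis
      using e3[of "k - 1" "l - 1" "m - 1"] by (simp add: n_def)
  next
    case True
    have two': "E i j 0 = 0" if "i + j = n" for i j
    proof (cases "i = 0 \<or> j = 0")
      case False
      then obtain i' j' where "i = Suc i'" "j = Suc j'" by (cases i; cases j) auto
      then show ?thesis using two[of i' j'] that by simp
    next
      case True
      then show ?thesis using one that sym(1)[of 0 n 0] by auto
    qed
    from True show ?thesis
      using two'[of k l] two'[of k m] two'[of l m] sym(2)[of k 0 m] sym(1)[of 0 l m] sym(2)[of l 0 m]
      by (auto simp: n_def)
  qed
qed

theorem serre_eq_value:
  assumes "comm (b 0) (comm (b 0) (comm (b 0) (x 0))) = - (4 * comm (b 0) (x 0))"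
  shows "serre k l m r = serre_value k l m r"
proof -
  define E where "E = (\<lambda>k l m. serre k l m r - serre_value k l m r)"
  have "E k l m = 0"
  proof (rule vanishing_by_power_sums)
    show "E k l m = E l k m" "E k l m = E k m l" for k l m
      using summand_sym[of r k l m] summand_sym[of r l m k] summand_sym[of r m k l]
      by (simp_all add: E_def serre_def Sym3_def serre_value_def Cyc3_def)
    show "E 0 0 0 = 0"
      using serre_2_shift[OF assms, of r]
      by (simp add: E_def serre_def Sym3_def serre_value_def Cyc3_def summand_def even_value_def)
        (rule null_elem_inject, simp only: null_elem_expand; simp)
    fix k l m
    assume "E k l m = 0"
    then have eq: "serre k l m r = serre_value k l m r" by (simp add: E_def)
    show "E (k + 1) l m + E k (l + 1) m + E k l (m + 1) = 0"
      using serre_shift[OF zb_shift zb_x, of k l m r]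
        serre_value_shift[OF zb_shift zb_x zb_h odd_one, of k l m r] eq
      by (simp add: E_def algebra_simps)
    show "E (k + 3) l m + E k (l + 3) m + E k l (m + 3) = 0"
      using serre_shift[OF z3_b z3_x, of k l m r]
        serre_value_shift[OF z3_b z3_x z3_h, of k l m r] eq
      by (simp add: E_def algebra_simps)
    have "3 * (serre (k + 2) l m r + serre k (l + 2) m r + serre k l (m + 2) r) =
        3 * (serre_value (k + 2) l m r + serre_value k (l + 2) m r + serre_value k l (m + 2) r)"
      unfolding serre_second_shift serre_value_second_shift eq ..
    then have "serre (k + 2) l m r + serre k (l + 2) m r + serre k l (m + 2) r =
        serre_value (k + 2) l m r + serre_value k (l + 2) m r + serre_value k l (m + 2) r"
      by (rule numeral_mult_cancel)
    then show "E (k + 2) l m + E k (l + 2) m + E k l (m + 2) = 0"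
      by (simp add: E_def algebra_simps)
  qed
  then show ?thesis by (simp add: E_def)
qed

end

section \<open>Cartan matrices of finite type\<close>

text \<open>The real symmetriser \<open>e\<close> belongs to the definite form and is not tied to
  the integral \<open>d\<close> of the Yangian; the argument for double bonds follows both along the
  diagram.\<close>

locale finite_cartan =
  fixes c :: "'i::finite \<Rightarrow> 'i \<Rightarrow> int" and e :: "'i \<Rightarrow> real"
  assumes diag: "c i i = 2"
    and off_diag: "i \<noteq> j \<Longrightarrow> c i j \<le> 0"
    and zero_sym: "c i j = 0 \<Longrightarrow> c j i = 0"
    and e_pos: "0 < e i"
    and e_sym: "e i * of_int (c i j) = e j * of_int (c j i)"
    and pos_def: "\<exists>i. x i \<noteq> 0 \<Longrightarrow>
      0 < (\<Sum>i\<in>UNIV. \<Sum>j\<in>UNIV. e i * of_int (c i j) * x i * x j)"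
    and indecomposable: "J \<noteq> {} \<Longrightarrow> J \<noteq> UNIV \<Longrightarrow> \<exists>i\<in>J. \<exists>j\<in>-J. c i j \<noteq> 0"
begin

definition form :: "('i \<Rightarrow> real) \<Rightarrow> real" where
  "form x = (\<Sum>i\<in>UNIV. \<Sum>j\<in>UNIV. e i * of_int (c i j) * x i * x j)"

text \<open>The inner product of the simple root \<alpha>_k with the vector \<Sum> x_j
  \<alpha>_j.\<close>

definition pairing :: "'i \<Rightarrow> ('i \<Rightarrow> real) \<Rightarrow> real" where
  "pairing k x = (\<Sum>j\<in>UNIV. e k * of_int (c k j) * x j)"

lemma form_add:
  assumes "x k = 0"
  shows "form (x(k := t)) = form x + 2 * t * pairing k x + 2 * e k * t\<^sup>2"
proof -
  define \<delta> where "\<delta> = (\<lambda>j. if j = k then t else 0)"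
  have upd: "x(k := t) = (\<lambda>j. x j + \<delta> j)"
    using assms by (auto simp: \<delta>_def)
  have "form (x(k := t)) = (\<Sum>i\<in>UNIV. \<Sum>j\<in>UNIV.
      e i * of_int (c i j) * x i * x j + e i * of_int (c i j) * x j * \<delta> i
      + e j * of_int (c j i) * x i * \<delta> j + e i * of_int (c i j) * \<delta> i * \<delta> j)"
    unfolding form_def upd
    by (intro sum.cong refl) (simp add: algebra_simps e_sym[of _ i for i])
  also have "\<dots> = form x + (\<Sum>i\<in>UNIV. \<Sum>j\<in>UNIV. e i * of_int (c i j) * x j * \<delta> i)
      + (\<Sum>j\<in>UNIV. \<Sum>i\<in>UNIV. e j * of_int (c j i) * x i * \<delta> j)
      + (\<Sum>i\<in>UNIV. \<Sum>j\<in>UNIV. e i * of_int (c i j) * \<delta> i * \<delta> j)"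
    unfolding form_def sum.distrib
    by (subst (3) sum.swap) (rule refl)
  also have "\<dots> = form x + 2 * (\<Sum>i\<in>UNIV. pairing i x * \<delta> i)
      + (\<Sum>i\<in>UNIV. \<Sum>j\<in>UNIV. e i * of_int (c i j) * \<delta> i * \<delta> j)"
    by (simp add: pairing_def sum_distrib_right)
  also have "(\<Sum>i\<in>UNIV. pairing i x * \<delta> i) = t * pairing k x"
    by (simp add: \<delta>_def if_distrib[of "\<lambda>y. _ * y"] cong: if_cong)
  also have "(\<Sum>i\<in>UNIV. \<Sum>j\<in>UNIV. e i * of_int (c i j) * \<delta> i * \<delta> j) = 2 * e k * t\<^sup>2"
    by (simp add: \<delta>_def if_distrib[of "\<lambda>y. _ * y"] if_distrib[of "\<lambda>y. y * _"] diag power2_eq_square cong: if_cong)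
  finally show ?thesis by (simp only: mult.assoc)
qed

lemma form_pos: "x z \<noteq> 0 \<Longrightarrow> 0 < form x"
  unfolding form_def by (rule pos_def) blast

lemma pairing_le:
  assumes "\<And>w. 0 \<le> x w" "x y = 0"
  shows "pairing y x \<le> e y * of_int (c y z) * x z"
proof -
  have nonpos: "e y * of_int (c y w) * x w \<le> 0" for w
  proof (cases "w = y")
    case False
    then have "of_int (c y w) * x w \<le> 0"
      using off_diag[of y w] assms(1)[of w] by (simp add: mult_nonpos_nonneg)
    then show ?thesis using e_pos[of y] by (simp add: mult.assoc mult_nonneg_nonpos)
  qed (simp add: assms)
  have "pairing y x = e y * of_int (c y z) * x z + (\<Sum>w\<in>UNIV - {z}. e y * of_int (c y w) * x w)"
    unfolding pairing_def by (rule sum.remove) auto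
  then show ?thesis using sum_nonpos[of "UNIV - {z}" "\<lambda>w. e y * of_int (c y w) * x w"] nonpos by simp
qed

text \<open>A strict Cauchy-Schwarz inequality for \<open>x\<close> and \<alpha>_y, which are
  independent as \<open>y\<close> lies outside the support of \<open>x\<close>. Nonnegative
  coordinates ensure that no other neighbour of \<open>y\<close> cancels the contribution of
  \<open>z\<close> to the pairing.\<close>

lemma neighbour_bound:
  assumes nonneg: "\<And>w. 0 \<le> x w" and "x y = 0" "x z \<noteq> 0"
  shows "of_int (c y z * c z y) * e z * (x z)\<^sup>2 < 2 * form x"
proof -
  have "y \<noteq> z" using assms by auto
  \<comment> \<open>The minimum point of the quadratic polynomial \<open>form (x(y := t))\<close> in
    \<open>t\<close>.\<close>
  define t where "t = - pairing y x / (2 * e y)"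
  have "0 < form (x(y := t))"
    using \<open>x z \<noteq> 0\<close> \<open>y \<noteq> z\<close> by (intro form_pos[of _ z]) simp
  also have "form (x(y := t)) = form x - (pairing y x)\<^sup>2 / (2 * e y)"
    using form_add[of x y t] \<open>x y = 0\<close> e_pos[of y] by (simp add: t_def power2_eq_square field_simps)
  finally have 1: "(pairing y x)\<^sup>2 < 2 * e y * form x"
    using e_pos[of y] by (simp add: field_simps)
  define p where "p = e y * of_int (c y z) * x z"
  have "of_int (c y z) * x z \<le> 0"
    using off_diag[OF \<open>y \<noteq> z\<close>] nonneg[of z] by (simp add: mult_nonpos_nonneg)
  then have "p \<le> 0"
    using e_pos[of y] by (simp add: p_def mult.assoc mult_nonneg_nonpos)
  moreover have "pairing y x \<le> p"
    unfolding p_def using assms by (intro pairing_le) auto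
  ultimately have "p\<^sup>2 \<le> (pairing y x)\<^sup>2"
    using power_mono[of "- p" "- pairing y x" 2] by simp
  moreover have "p\<^sup>2 = e y * (of_int (c y z * c z y) * e z * (x z)\<^sup>2)"
  proof -
    have "p\<^sup>2 = (e y * of_int (c y z)) * (e y * of_int (c y z)) * (x z)\<^sup>2"
      by (simp add: p_def power2_eq_square)
    also have "\<dots> = (e y * of_int (c y z)) * (e z * of_int (c z y)) * (x z)\<^sup>2"
      by (simp only: e_sym[of y z])
    finally show ?thesis by simp
  qed
  ultimately have "e y * (of_int (c y z * c z y) * e z * (x z)\<^sup>2) < e y * (2 * form x)"
    using 1 by (simp add: algebra_simps)
  then show ?thesis using e_pos[of y] by (simp only: mult_less_cancel_left_pos)
qed

lemma form_0: "form (\<lambda>_. 0) = 0" and pairing_0: "pairing k (\<lambda>_. 0) = 0"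
  by (simp_all add: form_def pairing_def)

lemma form_single: "form ((\<lambda>_. 0)(i := s)) = 2 * e i * s\<^sup>2"
  using form_add[of "\<lambda>_. 0" i s] by (simp add: form_0 pairing_0)

lemma form_pair:
  assumes "i \<noteq> j"
  shows "form ((\<lambda>_. 0)(i := s, j := t)) = 2 * e i * s\<^sup>2 + 2 * e j * t\<^sup>2 + 2 * e j * of_int (c j i) * s * t"
proof -
  have "pairing j ((\<lambda>_. 0)(i := s)) = e j * of_int (c j i) * s"
    by (simp add: pairing_def if_distrib[of "\<lambda>y. _ * y"] cong: if_cong)
  then show ?thesis
    using form_add[of "(\<lambda>_. 0)(i := s)" j t] assms by (simp add: form_single algebra_simps)
qed

lemma product_less_4:
  assumes "i \<noteq> j"
  shows "c i j * c j i < 4"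
proof -
  have "of_int (c i j * c j i) * e j * 1\<^sup>2 < 2 * form ((\<lambda>_. 0)(j := 1))"
    using neighbour_bound[of "(\<lambda>_. 0)(j := 1)" i j] assms by simp
  then have "e j * of_int (c i j * c j i) < e j * of_int 4"
    by (simp add: form_single mult.commute)
  then show ?thesis
    using e_pos[of j] by (simp only: mult_less_cancel_left_pos of_int_less_iff)
qed

lemma off_diag_cases:
  assumes "i \<noteq> j" "c i j \<noteq> 0"
  shows "c i j \<in> {-1, -2, -3}" "c j i \<le> -1" "c i j < -1 \<Longrightarrow> c j i = -1"
proof -
  define a b where "a = - c i j" and "b = - c j i"
  have a: "1 \<le> a" and b: "1 \<le> b"
    using off_diag[OF \<open>i \<noteq> j\<close>] off_diag[of j i] zero_sym[of j i] assms by (auto simp: a_def b_def order.order_iff_strict)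
  have ab: "a * b < 4" using product_less_4[OF \<open>i \<noteq> j\<close>] by (simp add: a_def b_def)
  have "a * 1 \<le> a * b" using a b by (intro mult_left_mono) auto
  then have "a \<le> 3" using ab by linarith
  then show "c i j \<in> {-1, -2, -3}" using a by (auto simp: a_def)
  show "c j i \<le> -1" using b by (simp add: b_def)
  assume "c i j < -1"
  then have "2 \<le> a" by (simp add: a_def)
  then have "2 * b \<le> a * b" using b by (intro mult_right_mono) auto
  then have "b < 2" using ab by linarith
  then show "c j i = -1" using b by (simp add: b_def)
qed

text \<open>By connectedness, a third node would be attached to one end of the bond. A root
  supported on the bond then violates \<open>neighbour_bound\<close>.\<close>

lemma triple_bond:
  assumes "c i j = -3"
  shows "type_G2 c"
proof -
  have "i \<noteq> j" using assms diag[of i] by auto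
  have ji: "c j i = -1" using off_diag_cases[OF \<open>i \<noteq> j\<close>] assms by simp
  have ej: "e j = 3 * e i" using e_sym[of i j] assms ji by simp
  have "UNIV = {i, j}"
  proof (rule ccontr)
    assume "UNIV \<noteq> {i, j}"
    then obtain z y where z: "z \<in> {i, j}" and y: "y \<notin> {i, j}" and "c z y \<noteq> 0"
      using indecomposable[of "{i, j}"] by auto
    then have "z \<noteq> y" by auto
    have "1 * 1 \<le> (- c y z) * (- c z y)"
      using off_diag_cases(1,2)[OF \<open>z \<noteq> y\<close> \<open>c z y \<noteq> 0\<close>] by (intro mult_mono) auto
    then have m: "1 \<le> of_int (c y z * c z y) * (1 :: real)"
      by (simp flip: of_int_mult)
    have bound: "of_int (c y z * c z y) * e z * (x z)\<^sup>2 < 2 * form x"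
      if "x = (\<lambda>_. 0)(j := s, i := t)" "0 < s" "0 < t" for x s t
      using that y z by (intro neighbour_bound) auto
    have e: "e z * r \<le> of_int (c y z * c z y) * e z * r" if "0 \<le> r" for r
      using mult_right_mono[OF m, of "e z * r"] e_pos[of z] that by simp
    show False
    \<comment> \<open>The witnesses are the highest root 2 \<alpha>_j + 3 \<alpha>_i of G_2 and its
      highest short root \<alpha>_j + 2 \<alpha>_i. In each case \<open>2 * form x\<close> equals
      e_z x_z^2 exactly, which contradicts the strict bound.\<close>
    proof (cases "z = j")
      case True
      then show False
        using bound[OF refl, of 2 3] e[of 4] \<open>i \<noteq> j\<close> e_pos[of i] by (simp add: form_pair assms ej)
    next
      case False
      then show False
        using bound[OF refl, of 1 2] e[of 4] \<open>i \<noteq> j\<close> e_pos[of i] z by (simp add: form_pair assms ej)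
    qed
  qed
  then show ?thesis unfolding type_G2_def using assms ji \<open>i \<noteq> j\<close> by blast
qed

context
  fixes d :: "'i \<Rightarrow> nat"
  assumes d: "coprime_symmetrizer c d"
begin

lemma d_sym: "int (d i) * c i j = int (d j) * c j i" and d_Gcd: "Gcd (range d) = 1"
  using d by (auto simp: coprime_symmetrizer_def)

text \<open>
  The set \<open>reached p q a\<close> consists of nodes that are joined to \<open>p\<close> by simple bonds avoiding
  \<open>q\<close>. If \<open>p\<close> and \<open>q\<close> are joined by a double bond, the vectors \<open>x\<close> have length at most that of
  \<open>a\<alpha>\<^sub>p / \<surd>2\<close>, which rules out a second double bond.
\<close>

definition reached :: "'i \<Rightarrow> 'i \<Rightarrow> real \<Rightarrow> 'i set" where
  "reached p q a = {z. d z = d p \<and> e z = e p \<and>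
     (\<exists>x. (\<forall>w. 0 \<le> x w) \<and> x z = a \<and> form x \<le> e p * a\<^sup>2 \<and>
       (\<forall>w. x w \<noteq> 0 \<longrightarrow> w = q \<or> x w = a \<and> d w = d p \<and> e w = e p))}"

text \<open>If \<open>x y\<close> is nonzero, the same \<open>x\<close> serves for \<open>y\<close>.
  Otherwise \<open>neighbour_bound\<close> gives c_yz c_zy < 2, so the bond is simple, and adding a
  \<alpha>_y changes the form by at most -2 e_p a^2 + 2 e_p a^2 = 0. Hence the length bound persists
  along the path.\<close>

lemma reached_step:
  assumes z: "z \<in> reached p q a" and "0 < a" and "c z y \<noteq> 0" "y \<noteq> q"
  shows "y \<in> reached p q a"
proof (cases "y = z")
  case False
  then have "z \<noteq> y" by simp
  from z obtain x where x: "\<And>w. 0 \<le> x w" "x z = a" "form x \<le> e p * a\<^sup>2"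
      "\<And>w. x w \<noteq> 0 \<Longrightarrow> w = q \<or> x w = a \<and> d w = d p \<and> e w = e p"
    and dz: "d z = d p" "e z = e p"
    by (auto simp: reached_def)
  show ?thesis
  proof (cases "x y = 0")
    case False
    with x(4)[OF this] \<open>y \<noteq> q\<close> have y: "x y = a" "d y = d p" "e y = e p" by auto
    show ?thesis
      unfolding reached_def using x y by (intro CollectI conjI exI[of _ x]) simp_all
  next
    case True
    have "of_int (c y z * c z y) * (e p * a\<^sup>2) < 2 * form x"
      using neighbour_bound[of x y z] x \<open>0 < a\<close> True dz by (simp add: mult.assoc)
    also have "\<dots> \<le> 2 * (e p * a\<^sup>2)" using x(3) by simp
    finally have m: "c y z * c z y < 2"
      using e_pos[of p] \<open>0 < a\<close> by (simp add: mult_less_cancel_right flip: of_int_mult)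
    have neg: "c z y \<le> -1" "c y z \<le> -1"
      using off_diag_cases(1,2)[OF \<open>z \<noteq> y\<close> \<open>c z y \<noteq> 0\<close>] by auto
    have "(- c y z) * 1 \<le> (- c y z) * (- c z y)" "1 * (- c z y) \<le> (- c y z) * (- c z y)"
      using neg by (intro mult_left_mono mult_right_mono; simp)+
    then have simple: "c y z = -1" "c z y = -1" using m neg by auto
    have "d y = d p" "e y = e p"
      using d_sym[of y z] e_sym[of y z] simple dz by simp_all
    have "a * pairing y x \<le> a * (e y * of_int (c y z) * x z)"
      using \<open>0 < a\<close> x True by (intro mult_left_mono pairing_le) auto
    then have "form (x(y := a)) \<le> form x"
      unfolding form_add[of x y a, OF True] using simple x(2) by (simp add: power2_eq_square algebra_simps)
    then have "form (x(y := a)) \<le> e p * a\<^sup>2" using x(3) by simp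
    moreover have "(x(y := a)) w \<noteq> 0 \<longrightarrow> w = q \<or> (x(y := a)) w = a \<and> d w = d p \<and> e w = e p" for w
      using x(4)[of w] \<open>d y = d p\<close> \<open>e y = e p\<close> by (cases "w = y") simp_all
    moreover have "0 \<le> (x(y := a)) w" for w
      using x(1)[of w] \<open>0 < a\<close> by simp
    ultimately show ?thesis
      unfolding reached_def using \<open>d y = d p\<close> \<open>e y = e p\<close>
      by (intro CollectI conjI exI[of _ "x(y := a)"]) simp_all
  qed
qed (use z in simp)

lemma double_bond:
  assumes "c i j = -2"
  shows "c j i = -1" "d i = 1" "d j = 2"
proof -
  have "i \<noteq> j" using assms diag[of i] by auto
  show ji: "c j i = -1" using off_diag_cases[OF \<open>i \<noteq> j\<close>] assms by simp
  have ej: "e j = 2 * e i" using e_sym[of i j] assms ji by simp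
  have dj: "d j = 2 * d i" using d_sym[of i j] assms ji by simp
  define R where "R = reached j i 1 \<union> reached i j 2"
  \<comment> \<open>The starting vectors are the short root \<alpha>_j + \<alpha>_i and the long
    root \<alpha>_j + 2 \<alpha>_i of the double bond. Both have form exactly e_p a^2, for p = j, a
    = 1 and for p = i, a = 2.\<close>
  have j: "j \<in> reached j i 1"
    unfolding reached_def using \<open>i \<noteq> j\<close> assms ej
    by (auto intro!: exI[of _ "(\<lambda>_. 0)(j := 1, i := 1)"] simp: form_pair split: if_splits)
  have i: "i \<in> reached i j 2"
    unfolding reached_def using \<open>i \<noteq> j\<close> assms ej
    by (auto intro!: exI[of _ "(\<lambda>_. 0)(j := 1, i := 2)"] simp: form_pair split: if_splits)
  have "R = UNIV"
  proof (rule ccontr)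
    assume "R \<noteq> UNIV"
    moreover have "R \<noteq> {}" using i by (auto simp: R_def)
    ultimately obtain z y where "z \<in> R" "y \<notin> R" "c z y \<noteq> 0"
      using indecomposable[of R] by auto
    \<comment> \<open>Each of the two sets can be left only towards its excluded node, and that node
      lies in the other set.\<close>
    then show False
      using reached_step[of z j i 1 y] reached_step[of z i j 2 y] i j by (auto simp: R_def)
  qed
  \<comment> \<open>On all of \<open>R\<close> the value of \<open>d\<close> is \<open>d i\<close>
    or \<open>d j = 2 * d i\<close>.\<close>
  have "d i dvd d z" for z
  proof -
    have "z \<in> R" by (simp add: \<open>R = UNIV\<close>)
    then have "d z = d j \<or> d z = d i" by (auto simp: R_def reached_def)
    then show ?thesis by (auto simp: dj)
  qed
  then have "d i dvd Gcd (range d)" by (auto intro: Gcd_greatest)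
  then show "d i = 1" by (simp add: d_Gcd)
  then show "d j = 2" by (simp add: dj)
qed

end

end

lemma finite_cartan_if_indecomposable_finite:
  assumes "indecomposable_finite_cartan_matrix c"
  obtains e where "finite_cartan c e"
proof -
  note c = assms[unfolded indecomposable_finite_cartan_matrix_def]
  from c obtain e :: "'a \<Rightarrow> real" where
    e: "\<forall>i. 0 < e i" "\<forall>i j. e i * of_int (c i j) = e j * of_int (c j i)"
      "\<forall>x. (\<exists>i. x i \<noteq> 0) \<longrightarrow> 0 < (\<Sum>i\<in>UNIV. \<Sum>j\<in>UNIV. e i * of_int (c i j) * x i * x j)"
    by (elim conjE exE)
  have "finite_cartan c e"
    using c e by unfold_locales simp_all
  then show ?thesis by (rule that)
qed

section \<open>Quotients of the free algebra\<close>

locale yangian_quotient = central_scalars sc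
  for sc :: "complex poly \<Rightarrow> 'a::ring_1" +
  fixes c :: "'i::finite \<Rightarrow> 'i \<Rightarrow> int" and d :: "'i \<Rightarrow> nat" and \<pi> :: "'i yfree \<Rightarrow> 'a"
  assumes \<pi>_add: "\<pi> (u + v) = \<pi> u + \<pi> v"
    and \<pi>_mult: "\<pi> (u * v) = \<pi> u * \<pi> v"
    and \<pi>_smul: "\<pi> (p \<cdot> u) = sc p * \<pi> u"
    and common: "u \<in> common_relators c d \<Longrightarrow> \<pi> u = 0"
begin

lemma \<pi>_0: "\<pi> 0 = 0"
  using \<pi>_add[of 0 0] by simp

lemma \<pi>_uminus: "\<pi> (- u) = - \<pi> u"
  using \<pi>_add[of "- u" u] by (simp add: \<pi>_0 eq_neg_iff_add_eq_0)

lemma \<pi>_diff: "\<pi> (u - v) = \<pi> u - \<pi> v"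
  using \<pi>_add[of u "- v"] by (simp add: \<pi>_uminus)

lemma \<pi>_comm: "\<pi> (comm u v) = comm (\<pi> u) (\<pi> v)" and \<pi>_acomm: "\<pi> (acomm u v) = acomm (\<pi> u) (\<pi> v)"
  by (simp_all add: comm_def acomm_def \<pi>_add \<pi>_diff \<pi>_mult)

lemma \<pi>_sum: "\<pi> (sum f A) = (\<Sum>a\<in>A. \<pi> (f a))"
  by (induction A rule: infinite_finite_induct) (simp_all add: \<pi>_0 \<pi>_add)

lemmas \<pi>_simps = \<pi>_0 \<pi>_add \<pi>_uminus \<pi>_diff \<pi>_comm \<pi>_acomm \<pi>_smul \<pi>_sum

abbreviation b :: "'i \<Rightarrow> nat \<Rightarrow> 'a" where "b i r \<equiv> \<pi> (b_gen i r)"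

abbreviation h :: "'i \<Rightarrow> int \<Rightarrow> 'a" where "h i s \<equiv> \<pi> (h_gen i s)"

lemma h_0: "even s \<or> s \<le> 0 \<Longrightarrow> h i s = 0"
  by (auto simp: h_gen_def \<pi>_0)

lemma hh: "comm (h i (int s)) (h j (int r)) = 0"
proof (cases "odd s \<and> odd r")
  case True
  then have "\<pi> (comm (h_gen i (int s)) (h_gen j (int r))) = 0"
    by (intro common[unfolded common_relators_def]) blast
  then show ?thesis by (simp add: \<pi>_simps)
qed (auto simp: h_0 comm_linear)

lemma hb: "comm (h i 1) (b j r) = sc [:of_int (2 * c i j):] * b j (Suc r)"
proof -
  have "\<pi> (comm (h_gen i 1) (b_gen j r) - [:of_int (2 * c i j):] \<cdot> b_gen j (r + 1)) = 0"
    unfolding common_relators_def by (rule common[unfolded common_relators_def]) blast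
  then show ?thesis by (simp add: \<pi>_simps)
qed

lemma bh:
  assumes "odd s"
  shows "comm (b j r) (h i (int s + 2)) - comm (b j (r + 2)) (h i (int s)) =
    - (sc (monom (of_nat (d i) * of_int (c i j)) 1) * acomm (b j (Suc r)) (h i (int s)))
    + sc (monom ((of_nat (d i))\<^sup>2 * (of_int (c i j))\<^sup>2 / 4) 2) * comm (b j r) (h i (int s))"
proof -
  have "\<pi> (comm (b_gen j r) (h_gen i (int s + 2)) - comm (b_gen j (r + 2)) (h_gen i (int s))
       - (- (monom (of_nat (d i) * of_int (c i j)) 1 \<cdot> acomm (b_gen j (r + 1)) (h_gen i (int s)))
          + monom ((of_nat (d i))\<^sup>2 * (of_int (c i j))\<^sup>2 / 4) 2 \<cdot> comm (b_gen j r) (h_gen i (int s)))) = 0"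
    by (rule common[unfolded common_relators_def]) (use assms in blast)
  then show ?thesis by (simp add: \<pi>_simps)
qed

lemma bb:
  "comm (b i s) (b j (Suc r)) - comm (b i (Suc s)) (b j r)
     + sc (monom (of_nat (d i) * of_int (c i j) / 2) 1) * acomm (b j r) (b i s) =
   (if i = j then 2 * ((- 1) ^ s * h i (int (s + r + 1))) else 0)"
proof -
  have "\<pi> (comm (b_gen i s) (b_gen j (r + 1)) - comm (b_gen i (s + 1)) (b_gen j r)
       + monom (of_nat (d i) * of_int (c i j) / 2) 1 \<cdot> acomm (b_gen j r) (b_gen i s)
       - (if i = j then [:2 * (- 1) ^ s:] \<cdot> h_gen i (int (r + s + 1)) else 0)) = 0"
    by (rule common[unfolded common_relators_def]) blast
  moreover have "sc [:2 * (- 1) ^ s:] = 2 * (- 1) ^ s"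
  proof -
    have "[:2 * (- 1) ^ s:] = (2 * (- 1) ^ s :: complex poly)"
      by (simp add: numeral_poly minus_one_power_iff)
    then show ?thesis by (simp add: sc_mult sc_numeral sc_power sc_uminus sc_1)
  qed
  ultimately show ?thesis
    by (auto simp: \<pi>_simps mult.assoc add.commute add.left_commute)
qed

text \<open>The coefficients solve the 2 by 2 linear system that prescribes the eigenvalue 1 on the
  shift of \<open>b i\<close> and 0 on that of \<open>b j\<close>; up to a factor, \<Delta> is its
  determinant.\<close>

definition shift_elem :: "'i \<Rightarrow> 'i \<Rightarrow> 'a" where
  "shift_elem i j = (let \<Delta> = of_int (4 - c i j * c j i)
     in sc [:1 / \<Delta>:] * h i 1 - sc [:of_int (c i j) / (2 * \<Delta>):] * h j 1)"

lemma comm_shift_elem: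
  assumes "c i i = 2" "c j j = 2" "c i j * c j i \<noteq> 4"
  shows "comm (shift_elem i j) (b i k) = b i (Suc k)" "comm (shift_elem i j) (b j k) = 0"
    "comm (shift_elem i j) (h m (int l)) = 0"
proof -
  define \<Delta> :: complex where "\<Delta> = of_int (4 - c i j * c j i)"
  have "\<Delta> \<noteq> 0" unfolding \<Delta>_def using assms(3) by (subst of_int_eq_0_iff) simp
  have cc: "of_int (c i j) * of_int (c j i) = 4 - \<Delta>" by (simp add: \<Delta>_def)
  have comm: "comm (shift_elem i j) (b m k) =
      sc ([:1 / \<Delta>:] * [:of_int (2 * c i m):] - [:of_int (c i j) / (2 * \<Delta>):] * [:of_int (2 * c j m):]) * b m (Suc k)"
    for m by (simp only: shift_elem_def Let_def \<Delta>_def[symmetric] comm_linear comm_sc hb sc_diff sc_mult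
        left_diff_distrib mult.assoc)
  have "[:1 / \<Delta>:] * [:of_int (2 * c i i):] - [:of_int (c i j) / (2 * \<Delta>):] * [:of_int (2 * c j i):] = 1"
    using \<open>\<Delta> \<noteq> 0\<close> cc assms(1) by (simp add: one_pCons field_simps)
  then show "comm (shift_elem i j) (b i k) = b i (Suc k)" unfolding comm by (simp add: sc_1)
  have "[:1 / \<Delta>:] * [:of_int (2 * c i j):] - [:of_int (c i j) / (2 * \<Delta>):] * [:of_int (2 * c j j):] = 0"
    using \<open>\<Delta> \<noteq> 0\<close> assms(2) by (simp add: field_simps)
  then show "comm (shift_elem i j) (b j k) = 0" by (simp only: comm sc_0 mult_zero_left)
  show "comm (shift_elem i j) (h m (int l)) = 0"
    using hh[of _ 1] by (simp add: shift_elem_def Let_def comm_linear comm_sc)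
qed

lemma shift_pair:
  assumes "c i i = 2" "c j j = 2" "c i j * c j i \<noteq> 4"
  shows "shift_pair sc (b i) (b j) (shift_elem i j) (shift_elem j i)"
  using comm_shift_elem[OF assms] comm_shift_elem[of j i] assms
  by unfold_locales (simp_all add: mult.commute)

lemma serre_pair:
  assumes "c i i = 2" "c j j = 2" "c i j * c j i \<noteq> 4"
  shows "serre_pair sc (b i) (b j) (shift_elem i j) (shift_elem j i) (\<lambda>l. h i (int l))"
proof -
  interpret shift_pair sc "b i" "b j" "shift_elem i j" "shift_elem j i"
    by (rule shift_pair[OF assms])
  show ?thesis
    by unfold_locales (use comm_shift_elem(3)[OF assms] in \<open>auto simp: h_0\<close>)
qed

lemma serre_pair_1:
  assumes "c i i = 2" "c j j = 2" "c i j = -1" "c j i \<noteq> -4"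
  shows "serre_pair_1 sc (b i) (b j) (shift_elem i j) (shift_elem j i) (\<lambda>l. h i (int l))
    (monom (of_nat (d i) / 2) 1)"
proof -
  interpret serre_pair sc "b i" "b j" "shift_elem i j" "shift_elem j i" "\<lambda>l. h i (int l)"
    by (rule serre_pair) (use assms in auto)
  have "i \<noteq> j" using assms by auto
  have "monom (of_nat (d i) * of_int (c i j) / 2) 1 = - monom (of_nat (d i) / 2 :: complex) 1"
    using assms by (simp add: minus_monom)
  moreover have "monom (of_nat (d i) * of_int (c i i) / 2) 1 = 2 * monom (of_nat (d i) / 2 :: complex) 1"
    using assms by (simp add: mult_2 add_monom)
  ultimately show ?thesis
    using bb[of i _ j] bb[of i _ i] \<open>i \<noteq> j\<close>
    by unfold_locales (simp_all add: sc_uminus sc_mult sc_numeral mult.assoc acomm_swap[of "b j _"])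
qed

text \<open>Relation (3) at s = 1 leaves the anticommutator of h_{i,1} and b_{j,r+1}. The commutator
  with the square of h_{i,1} is a multiple of the same anticommutator, and the factor hbar d_i / 2
  makes the two cancel.\<close>

lemma comm_h3:
  "comm (h i 3 - sc (monom (of_nat (d i) / 2) 1) * (h i 1 * h i 1)) (b j r) =
   sc [:of_int (2 * c i j):] * b j (r + 3)
     + sc (monom ((of_nat (d i))\<^sup>2 * (of_int (c i j)) ^ 3 / 2) 2) * b j (Suc r)"
proof -
  define A where "A = acomm (h i 1) (b j (Suc r))"
  have "comm (h i 1 * h i 1) (b j r) = acomm (h i 1) (comm (h i 1) (b j r))"
    by (simp add: comm_def acomm_def algebra_simps)
  then have sq: "comm (h i 1 * h i 1) (b j r) = sc [:of_int (2 * c i j):] * A"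
    by (simp add: hb acomm_sc A_def)
  have merge: "sc p * (sc q * y) = sc (p * q) * y" for p q y
    by (simp only: sc_mult mult.assoc)
  have m1: "monom (of_nat (d i) / 2) 1 * [:of_int (2 * c i j):] = monom (of_nat (d i) * of_int (c i j) :: complex) 1"
    by (simp add: monom_altdef)
  have m2: "monom ((of_nat (d i))\<^sup>2 * (of_int (c i j))\<^sup>2 / 4) 2 * [:of_int (2 * c i j):] =
      monom ((of_nat (d i))\<^sup>2 * (of_int (c i j)) ^ 3 / 2 :: complex) 2"
    by (simp add: monom_altdef power2_eq_square power3_eq_cube)
  have "comm (h i 3) (b j r) = comm (h i 1) (b j (r + 2))
      + sc (monom (of_nat (d i) * of_int (c i j)) 1) * A
      + sc (monom ((of_nat (d i))\<^sup>2 * (of_int (c i j))\<^sup>2 / 4) 2) * comm (h i 1) (b j r)"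
    using bh[of 1 j r i] comm_swap[of "b j _" "h i _"]
    by (simp add: A_def acomm_swap[of "h i 1"] algebra_simps)
  then have h3: "comm (h i 3) (b j r) = sc [:of_int (2 * c i j):] * b j (r + 3)
      + sc (monom (of_nat (d i) * of_int (c i j)) 1) * A
      + sc (monom ((of_nat (d i))\<^sup>2 * (of_int (c i j)) ^ 3 / 2) 2) * b j (Suc r)"
    unfolding hb merge m2 by (simp add: numeral_3_eq_3)
  show ?thesis unfolding comm_linear comm_sc sq merge m1 h3 by simp
qed

lemma serre_pair_2:
  assumes "c i i = 2" "c j j = 2" "c i j = -2" "c j i = -1" "d i = 1" "d j = 2"
  obtains z3 where "serre_pair_2 sc (b i) (b j) (shift_elem i j) (shift_elem j i) (\<lambda>l. h i (int l)) (monom 1 1) z3"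
proof -
  interpret serre_pair sc "b i" "b j" "shift_elem i j" "shift_elem j i" "\<lambda>l. h i (int l)"
    by (rule serre_pair) (use assms in auto)
  have "i \<noteq> j" using assms by auto
  define g where "g = (\<lambda>i. h i 3 - sc (monom (of_nat (d i) / 2) 1) * (h i 1 * h i 1))"
  \<comment> \<open>Half of \<open>g i + g j\<close> has leading coefficient c_ii + c_ji = 1 on b_i
    and c_ij + c_jj = 0 on b_j. Its lower terms raise the index by 1, with coefficients hbar^2 on
    b_i and 6 hbar^2 on b_j; the shift elements remove them.\<close>
  define z3 where "z3 = sc [:1 / 2:] * (g i + g j) - sc (monom 1 2) * shift_elem i j - sc (monom 6 2) * shift_elem j i"
  note shift = comm_shift_elem[of i j] comm_shift_elem[of j i]
  have g_h: "comm (g m) (h i (int l)) = 0" for m l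
    using hh[of m 1 i l] hh[of m 3 i l]
    by (simp add: g_def comm_linear comm_mult_left comm_sc_left)
  have g_b: "comm (g m) (b n k) = sc [:of_int (2 * c m n):] * b n (k + 3)
     + sc (monom ((of_nat (d m))\<^sup>2 * (of_int (c m n)) ^ 3 / 2) 2) * b n (Suc k)" for m n k
    unfolding g_def by (rule comm_h3)
  have "comm z3 (b i k) = sc ([:1 / 2:] * ([:of_int (2 * c i i):] + [:of_int (2 * c j i):])) * b i (k + 3)
      + sc ([:1 / 2:] * (monom ((of_nat (d i))\<^sup>2 * (of_int (c i i)) ^ 3 / 2) 2
        + monom ((of_nat (d j))\<^sup>2 * (of_int (c j i)) ^ 3 / 2) 2) - monom 1 2) * b i (Suc k)" for k
    unfolding z3_def comm_linear comm_sc g_b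
    using shift(1)[of k] shift(5)[of k] assms
    by (simp only: sc_add sc_diff sc_mult) (simp add: algebra_simps)
  moreover have "[:1 / 2:] * ([:of_int (2 * c i i):] + [:of_int (2 * c j i):]) = (1 :: complex poly)"
    using assms by (simp add: one_pCons)
  moreover have "[:1 / 2:] * (monom ((of_nat (d i))\<^sup>2 * (of_int (c i i)) ^ 3 / 2) 2
        + monom ((of_nat (d j))\<^sup>2 * (of_int (c j i)) ^ 3 / 2) 2) - monom 1 2 = (0 :: complex poly)"
    using assms by (simp add: add_monom smult_monom)
  ultimately have z3_b: "comm z3 (b i k) = b i (k + 3)" for k
    by (simp only: sc_1 sc_0 mult_1_left mult_zero_left add_0_right)
  have "comm z3 (b j k) = sc ([:1 / 2:] * ([:of_int (2 * c i j):] + [:of_int (2 * c j j):])) * b j (k + 3)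
      + sc ([:1 / 2:] * (monom ((of_nat (d i))\<^sup>2 * (of_int (c i j)) ^ 3 / 2) 2
        + monom ((of_nat (d j))\<^sup>2 * (of_int (c j j)) ^ 3 / 2) 2) - monom 6 2) * b j (Suc k)" for k
    unfolding z3_def comm_linear comm_sc g_b
    using shift(2)[of k] shift(4)[of k] assms
    by (simp only: sc_add sc_diff sc_mult) (simp add: algebra_simps)
  moreover have "[:1 / 2:] * ([:of_int (2 * c i j):] + [:of_int (2 * c j j):]) = (0 :: complex poly)"
    using assms by simp
  moreover have "[:1 / 2:] * (monom ((of_nat (d i))\<^sup>2 * (of_int (c i j)) ^ 3 / 2) 2
        + monom ((of_nat (d j))\<^sup>2 * (of_int (c j j)) ^ 3 / 2) 2) - monom 6 2 = (0 :: complex poly)"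
    using assms by (simp add: add_monom smult_monom)
  ultimately have "comm z3 (b j k) = 0" for k
    by (simp only: sc_0 mult_zero_left add_0_right)
  moreover have "comm z3 (h i (int l)) = 0" for l
    using assms shift by (simp add: z3_def comm_linear comm_sc g_h)
  moreover have "monom (of_nat (d i) * of_int (c i j) / 2) 1 = - monom (1 :: complex) 1"
    using assms by (simp add: minus_monom)
  moreover have "monom (of_nat (d i) * of_int (c i i) / 2) 1 = monom (1 :: complex) 1"
    using assms by simp
  ultimately show thesis
    using bb[of i _ j] bb[of i _ i] \<open>i \<noteq> j\<close> z3_b
    by (intro that[of z3], unfold_locales) (simp_all add: sc_uminus acomm_swap[of "b j _"])
qed

definition kills :: "'i yfree set \<Rightarrow> bool" where
  "kills X \<longleftrightarrow> (\<forall>u\<in>X. \<pi> u = 0)"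

section \<open>The right-hand sides of the current Serre relations in the quotient\<close>

lemma \<pi>_serre1_rhs:
  fixes r k l :: nat
  assumes \<theta>: "\<theta> = monom (of_nat (d i) / 2) 1"
    and "serre_pair_1 sc (b i) (b j) zb zx (\<lambda>l. h i (int l)) \<theta>"
  shows "\<pi> (serre1_rhs d i j r k l) =
    serre_pair_1.serre_value sc (b j) (\<lambda>l. h i (int l)) \<theta> k l r"
proof -
  interpret serre_pair_1 sc "b i" "b j" zb zx "\<lambda>l. h i (int l)" \<theta>
    by (fact assms)
  show ?thesis
  proof (cases "even (k + l)")
    case True
    define n where "n = (k + l) div 2"
    have kl: "k + l = 2 * n" using True by (simp add: n_def)
    have power: "\<theta> ^ m = monom ((of_nat (d i) / 2) ^ m) m" for m
      by (simp add: \<theta> monom_power)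
    have index: "int (2 * n) - 2 * int t - 1 = int (2 * n - 2 * t - 1)" if "t < n" for t
      using that by simp
    have c0: "sc (monom (2 * (of_nat (d i) / 2) ^ (2 * n)) (2 * n)) = 2 * sc \<theta> ^ (2 * n)"
    proof -
      have "monom (2 * (of_nat (d i) / 2) ^ (2 * n)) (2 * n) = 2 * \<theta> ^ (2 * n)"
        unfolding power by (simp add: numeral_poly smult_monom)
      then show ?thesis by (simp only: sc_mult sc_numeral sc_power)
    qed
    have c1: "sc (monom ((of_nat (d i) / 2) ^ (2 * t)) (2 * t)) = sc \<theta> ^ (2 * t)" for t
      by (simp only: sc_power flip: power)
    have c2: "sc (monom ((of_nat (d i)) ^ (2 * t + 1) / 2 ^ (2 * t)) (2 * t + 1)) = 2 * sc \<theta> ^ (2 * t + 1)" for t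
    proof -
      have "monom ((of_nat (d i)) ^ (2 * t + 1) / 2 ^ (2 * t)) (2 * t + 1) = 2 * \<theta> ^ (2 * t + 1)"
        unfolding power by (simp add: numeral_poly smult_monom power_divide)
      then show ?thesis by (simp only: sc_mult sc_numeral sc_power)
    qed
    have "\<pi> (serre1_rhs d i j r k l) = (- 1) ^ (k + 1) *
       (2 * sc \<theta> ^ (2 * n) * b j r
        + (\<Sum>t<n. sc \<theta> ^ (2 * t) * comm (b j (r + 1)) (h i (int (2 * n) - 2 * int t - 1)))
        + (\<Sum>t<n. 2 * sc \<theta> ^ (2 * t + 1) * acomm (h i (int (2 * n) - 2 * int t - 1)) (b j r)))"
      unfolding serre1_rhs_def if_P[OF True] n_def[symmetric] unfolding kl \<pi>_simps sc_sign c0 c1 c2 ..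
    also have "(\<Sum>t<n. sc \<theta> ^ (2 * t) * comm (b j (r + 1)) (h i (int (2 * n) - 2 * int t - 1))) =
        (\<Sum>t<n. sc \<theta> ^ (2 * t) * comm (b j (Suc r)) (h i (int (2 * n - 2 * t - 1))))"
      by (rule sum.cong) (simp_all only: index lessThan_iff Suc_eq_plus1)
    also have "(\<Sum>t<n. 2 * sc \<theta> ^ (2 * t + 1) * acomm (h i (int (2 * n) - 2 * int t - 1)) (b j r)) =
        (\<Sum>t<n. 2 * (sc \<theta> ^ (2 * t + 1) * acomm (h i (int (2 * n - 2 * t - 1))) (b j r)))"
      by (rule sum.cong) (simp_all only: index lessThan_iff mult.assoc)
    also have "(- 1) ^ (k + 1) * (2 * sc \<theta> ^ (2 * n) * b j r
        + (\<Sum>t<n. sc \<theta> ^ (2 * t) * comm (b j (Suc r)) (h i (int (2 * n - 2 * t - 1))))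
        + (\<Sum>t<n. 2 * (sc \<theta> ^ (2 * t + 1) * acomm (h i (int (2 * n - 2 * t - 1))) (b j r)))) =
      serre_value k l r"
      unfolding serre_value_def even_value_def kl by (simp add: mult.assoc)
    finally show ?thesis .
  qed (simp add: serre1_rhs_def serre_value_def \<pi>_0)
qed

lemma \<pi>_serre2_rhs:
  fixes r k l m :: nat
  assumes \<theta>: "\<theta> = monom 1 1" and "serre_pair_2 sc (b i) (b j) zb zx (\<lambda>l. h i (int l)) \<theta> z3"
    and "d i = 1"
  shows "\<pi> (serre2_rhs d i j r k l m) =
    serre_pair_2.serre_value sc (b i) (b j) (\<lambda>l. h i (int l)) \<theta> k l m r"
proof -
  interpret serre_pair_2 sc "b i" "b j" zb zx "\<lambda>l. h i (int l)" \<theta> z3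
    by (fact assms)
  have T: "\<pi> (serre2_T d i j r k p s) = T r (k + 2 * p) (h i s)" for k p s
  proof -
    have coeff: "sc (monom (numeral w * of_nat (d i)) 1) = numeral w * sc \<theta>" for w
    proof -
      have "monom (numeral w * of_nat (d i)) 1 = [:numeral w:] * \<theta>"
        using assms by (simp add: smult_monom)
      then show ?thesis by (simp only: sc_mult sc_const_numeral)
    qed
    show ?thesis
      unfolding serre2_T_def T_def \<pi>_simps sc_const_numeral coeff by (simp add: mult.assoc)
  qed
  define H where "H = (\<lambda>k l m. \<pi> (
       (\<Sum>s<l + m. \<Sum>p\<le>s.
          monom ((- 1) ^ (m + p + 1) * of_nat (s choose p) / 3 ^ (p + 1)) (2 * s - 2 * p)
            \<cdot> serre2_T d i j r k p (int (l + m) - 2 * int s - 1))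
       + [:8:] \<cdot>
         (if even (l + m)
          then (\<Sum>p\<le>(l + m) div 2.
                  monom ((- 1) ^ (m + p + 1) * of_nat (((l + m) div 2) choose p) / 3 ^ p)
                        (l + m - 2 * p)
                    \<cdot> comm (b_gen i (k + 2 * p)) (b_gen j r))
          else 0)))"
  have "H k l m = summand r k l m" for k l m
  proof -
    define sg :: "complex poly" where "sg = [:(- 1) ^ (m + 1):]"
    have sg: "sc sg = (- 1) ^ (m + 1)"
      unfolding sg_def by (rule sc_sign)
    have inner: "(\<Sum>p\<le>s. sc (monom ((- 1) ^ (m + p + 1) * of_nat (s choose p) / 3 ^ (p + 1)) (2 * s - 2 * p))
          * T r (k + 2 * p) y) = (- 1) ^ (m + 1) * (sc [:1 / 3:] * iterate_sq s (\<lambda>k. T r k y) k)" for s y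
    proof -
      have "monom ((- 1) ^ (m + p + 1) * of_nat (s choose p) / 3 ^ (p + 1)) (2 * s - 2 * p)
        = sg * ([:1 / 3:] * ([:(- 1) ^ p * of_nat (s choose p) / 3 ^ p:] * \<theta> ^ (2 * s - 2 * p)))" for p
        by (simp add: sg_def \<theta> monom_power smult_monom power_add)
      then show ?thesis
        unfolding iterate_sq_eq_sum sg[symmetric] by (simp only: sc_mult sum_distrib_left mult.assoc)
    qed
    show ?thesis
    proof (cases "even (l + m)")
      \<comment> \<open>All indices of \<open>h\<close> in the sum are then even, so every
        \<open>T\<close> vanishes.\<close>
      case False
      then have "h i (int (l + m) - 2 * int s - 1) = 0" for s
        by (intro h_0) auto
      then show ?thesis using False by (simp add: H_def summand_def \<pi>_simps T T_linear)
    next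
      case True
      define n where "n = (l + m) div 2"
      have lm: "l + m = 2 * n" using True by (simp add: n_def)
      have outer: "(\<Sum>p\<le>n. sc (monom ((- 1) ^ (m + p + 1) * of_nat (n choose p) / 3 ^ p) (2 * n - 2 * p))
          * comm (b i (k + 2 * p)) (b j r)) = (- 1) ^ (m + 1) * iterate_sq n (\<lambda>k. comm (b i k) (b j r)) k"
      proof -
        have "monom ((- 1) ^ (m + p + 1) * of_nat (n choose p) / 3 ^ p) (2 * n - 2 * p)
          = sg * ([:(- 1) ^ p * of_nat (n choose p) / 3 ^ p:] * \<theta> ^ (2 * n - 2 * p))" for p
          by (simp add: sg_def \<theta> monom_power smult_monom power_add)
        then show ?thesis
          unfolding iterate_sq_eq_sum sg[symmetric] by (simp only: sc_mult sum_distrib_left mult.assoc)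
      qed
      have "H k l m = (\<Sum>s<2 * n. (- 1) ^ (m + 1) * (sc [:1 / 3:] *
            iterate_sq s (\<lambda>k. T r k (h i (int (2 * n) - 2 * int s - 1))) k))
          + 8 * ((- 1) ^ (m + 1) * iterate_sq n (\<lambda>k. comm (b i k) (b j r)) k)"
        unfolding H_def if_P[OF True] \<pi>_simps T n_def[symmetric] unfolding lm inner outer sc_const_numeral ..
      also have "(\<Sum>s<2 * n. (- 1) ^ (m + 1) * (sc [:1 / 3:] *
            iterate_sq s (\<lambda>k. T r k (h i (int (2 * n) - 2 * int s - 1))) k)) =
         (\<Sum>s<n. (- 1) ^ (m + 1) * (sc [:1 / 3:] *
            iterate_sq s (\<lambda>k. T r k (h i (int (2 * n - 2 * s - 1)))) k))"
      \<comment> \<open>For \<open>s \<ge> n\<close> the integer index is negative. For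
        \<open>s < n\<close> it agrees with the truncated difference of natural numbers.\<close>
      proof (rule sum.mono_neutral_cong_right)
        show "\<forall>s\<in>{..<2 * n} - {..<n}. (- 1) ^ (m + 1) * (sc [:1 / 3:] *
            iterate_sq s (\<lambda>k. T r k (h i (int (2 * n) - 2 * int s - 1))) k) = 0"
        proof
          fix s assume "s \<in> {..<2 * n} - {..<n}"
          then have "h i (int (2 * n) - 2 * int s - 1) = 0" by (intro h_0) auto
          moreover have "iterate_sq s (\<lambda>k. 0) k = 0" by (simp add: iterate_sq_eq_sum)
          ultimately show "(- 1) ^ (m + 1) * (sc [:1 / 3:] *
            iterate_sq s (\<lambda>k. T r k (h i (int (2 * n) - 2 * int s - 1))) k) = 0"
            by (simp add: T_linear)
        qed
      next
        fix s assume "s \<in> {..<n}"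
        then have "int (2 * n) - 2 * int s - 1 = int (2 * n - 2 * s - 1)" by auto
        then show "(- 1) ^ (m + 1) * (sc [:1 / 3:] *
            iterate_sq s (\<lambda>k. T r k (h i (int (2 * n) - 2 * int s - 1))) k) =
          (- 1) ^ (m + 1) * (sc [:1 / 3:] * iterate_sq s (\<lambda>k. T r k (h i (int (2 * n - 2 * s - 1)))) k)"
          by (simp only:)
      qed auto
      also have "\<dots> + 8 * ((- 1) ^ (m + 1) * iterate_sq n (\<lambda>k. comm (b i k) (b j r)) k) = summand r k l m"
        unfolding sum_distrib_left[symmetric]
        by (cases "even m") (use True lm in \<open>simp_all add: summand_def even_value_def\<close>)
      finally show ?thesis .
    qed
  qed
  then show ?thesis
    by (simp add: serre2_rhs_def serre_value_def Cyc3_def H_def \<pi>_add)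
qed

section \<open>The finite Serre relations in the quotient\<close>

lemma kills_finite_serre_D:
  assumes "kills (finite_serre_relators c)"
  shows "c i j = 0 \<Longrightarrow> comm (b i 0) (b j 0) = 0"
    and "c i j = -1 \<Longrightarrow> comm (b i 0) (comm (b i 0) (b j 0)) = - b j 0"
    and "c i j = -2 \<Longrightarrow> comm (b i 0) (comm (b i 0) (comm (b i 0) (b j 0))) = - (4 * comm (b i 0) (b j 0))"
    and "c i j = -3 \<Longrightarrow> comm (b i 0) (comm (b i 0) (comm (b i 0) (comm (b i 0) (b j 0)))) =
      - (10 * comm (b i 0) (comm (b i 0) (b j 0))) - 9 * b j 0"
proof -
  note killed = assms[unfolded kills_def finite_serre_relators_def, rule_format]
  show "comm (b i 0) (b j 0) = 0" if "c i j = 0"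
  proof -
    have "\<pi> (comm (b_gen i 0) (b_gen j 0)) = 0"
      by (rule killed) (use that in blast)
    then show ?thesis unfolding \<pi>_simps .
  qed
  show "comm (b i 0) (comm (b i 0) (b j 0)) = - b j 0" if "c i j = -1"
  proof -
    have "\<pi> (comm (b_gen i 0) (comm (b_gen i 0) (b_gen j 0)) - (- b_gen j 0)) = 0"
      by (rule killed) (use that in blast)
    then show ?thesis unfolding \<pi>_simps by (simp add: eq_neg_iff_add_eq_0)
  qed
  show "comm (b i 0) (comm (b i 0) (comm (b i 0) (b j 0))) = - (4 * comm (b i 0) (b j 0))" if "c i j = -2"
  proof -
    have "\<pi> (comm (b_gen i 0) (comm (b_gen i 0) (comm (b_gen i 0) (b_gen j 0)))
       - (- ([:4:] \<cdot> comm (b_gen i 0) (b_gen j 0)))) = 0"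
      by (rule killed) (use that in blast)
    then show ?thesis unfolding \<pi>_simps sc_const_numeral by (simp add: eq_neg_iff_add_eq_0)
  qed
  show "comm (b i 0) (comm (b i 0) (comm (b i 0) (comm (b i 0) (b j 0)))) =
      - (10 * comm (b i 0) (comm (b i 0) (b j 0))) - 9 * b j 0" if "c i j = -3"
  proof -
    have "\<pi> (comm (b_gen i 0) (comm (b_gen i 0) (comm (b_gen i 0) (comm (b_gen i 0) (b_gen j 0))))
       - (- ([:10:] \<cdot> comm (b_gen i 0) (comm (b_gen i 0) (b_gen j 0))) - [:9:] \<cdot> b_gen j 0)) = 0"
      by (rule killed) (use that in blast)
    then show ?thesis unfolding \<pi>_simps sc_const_numeral by (simp only: eq_iff_diff_eq_0[symmetric])
  qed
qed

lemma kills_finite_serre_I: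
  assumes "\<And>i j. c i j = 0 \<Longrightarrow> comm (b i 0) (b j 0) = 0"
    and "\<And>i j. c i j = -1 \<Longrightarrow> comm (b i 0) (comm (b i 0) (b j 0)) = - b j 0"
    and "\<And>i j. c i j = -2 \<Longrightarrow>
      comm (b i 0) (comm (b i 0) (comm (b i 0) (b j 0))) = - (4 * comm (b i 0) (b j 0))"
    and "\<And>i j. c i j = -3 \<Longrightarrow> comm (b i 0) (comm (b i 0) (comm (b i 0) (comm (b i 0) (b j 0)))) =
      - (10 * comm (b i 0) (comm (b i 0) (b j 0))) - 9 * b j 0"
  shows "kills (finite_serre_relators c)"
proof -
  show ?thesis
    unfolding kills_def finite_serre_relators_def
    by (auto simp only: Un_iff mem_Collect_eq \<pi>_simps sc_const_numeral assms diff_self)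
qed

end

section \<open>Comparison of the families of Serre relators\<close>

locale finite_yangian_quotient = yangian_quotient sc c d \<pi> + finite_cartan c e
  for sc :: "complex poly \<Rightarrow> 'a::ring_1" and c :: "'i::finite \<Rightarrow> 'i \<Rightarrow> int" and d \<pi> e +
  assumes d: "coprime_symmetrizer c d"
begin

lemma negative_entry:
  assumes "c i j < 0"
  shows "i \<noteq> j" "c i j * c j i < 4"
proof -
  show "i \<noteq> j" using assms diag[of i] by auto
  then show "c i j * c j i < 4" by (rule product_less_4)
qed

lemma kills_finite_imp_G2:
  assumes "kills (finite_serre_relators c)"
  shows "kills (G2_serre_relators c)"
proof -
  have 1: "comm (b i 0) (comm (b i 0) (b j r)) = - b j r" if "c i j = -1" for i j r
  proof -
    interpret shift_pair sc "b i" "b j" "shift_elem i j" "shift_elem j i"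
      using negative_entry[of i j] that diag by (intro shift_pair) auto
    show ?thesis by (rule serre_1_shift[OF kills_finite_serre_D(2)[OF assms that]])
  qed
  have 3: "comm (b i 0) (comm (b i 0) (comm (b i 0) (comm (b i 0) (b j r)))) =
      - (10 * comm (b i 0) (comm (b i 0) (b j r))) - 9 * b j r" if "c i j = -3" for i j r
  proof -
    interpret shift_pair sc "b i" "b j" "shift_elem i j" "shift_elem j i"
      using negative_entry[of i j] that diag by (intro shift_pair) auto
    show ?thesis by (rule serre_3_shift[OF kills_finite_serre_D(4)[OF assms that]])
  qed
  show ?thesis
    unfolding kills_def G2_serre_relators_def
    by (auto simp only: Un_iff mem_Collect_eq \<pi>_simps sc_const_numeral 1 3 diff_self)
qed

lemma kills_finite_imp_current:
  assumes "kills (finite_serre_relators c)"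
  shows "kills (current_serre_relators c d)"
proof -
  have 0: "comm (b i k) (b j r) = 0" if "c i j = 0" for i j k r
  proof -
    interpret shift_pair sc "b i" "b j" "shift_elem i j" "shift_elem j i"
      using that diag by (intro shift_pair) auto
    show ?thesis by (rule serre_0_shift[OF kills_finite_serre_D(1)[OF assms that]])
  qed
  have 1: "Sym2 (\<lambda>k l. comm (b i k) (comm (b i l) (b j r))) k l = \<pi> (serre1_rhs d i j r k l)"
    if "c i j = -1" for i j r k l
  proof -
    have pair: "serre_pair_1 sc (b i) (b j) (shift_elem i j) (shift_elem j i) (\<lambda>l. h i (int l))
        (monom (of_nat (d i) / 2) 1)"
      using negative_entry[of i j] that diag by (intro serre_pair_1) auto
    interpret serre_pair_1 sc "b i" "b j" "shift_elem i j" "shift_elem j i" "\<lambda>l. h i (int l)"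
        "monom (of_nat (d i) / 2) 1"
      by (fact pair)
    show ?thesis
      unfolding \<pi>_serre1_rhs[OF refl pair] serre_def[symmetric]
      by (rule serre_eq_value[OF kills_finite_serre_D(2)[OF assms that]])
  qed
  have 2: "Sym3 (\<lambda>k l m. comm (b i k) (comm (b i l) (comm (b i m) (b j r)))) k l m =
      \<pi> (serre2_rhs d i j r k l m)" if "c i j = -2" for i j r k l m
  proof -
    note entry = that and bond = double_bond[OF d that]
    obtain z3 where pair: "serre_pair_2 sc (b i) (b j) (shift_elem i j) (shift_elem j i) (\<lambda>l. h i (int l)) (monom 1 1) z3"
      using serre_pair_2[OF diag diag entry bond] .
    interpret serre_pair_2 sc "b i" "b j" "shift_elem i j" "shift_elem j i" "\<lambda>l. h i (int l)" "monom 1 1" z3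
      by (fact pair)
    show ?thesis
      unfolding \<pi>_serre2_rhs[OF refl pair bond(2)] serre_def[symmetric]
      by (rule serre_eq_value[OF kills_finite_serre_D(3)[OF assms entry]])
  qed
  have Sym2: "\<pi> (Sym2 F k l) = Sym2 (\<lambda>k l. \<pi> (F k l)) k l"
    and Sym3: "\<pi> (Sym3 G k l m) = Sym3 (\<lambda>k l m. \<pi> (G k l m)) k l m" for F G k l m
    by (simp_all add: Sym2_def Sym3_def \<pi>_add)
  show ?thesis
    unfolding kills_def current_serre_relators_def
    by (auto simp only: Un_iff mem_Collect_eq \<pi>_simps Sym2 Sym3 0 1 2 diff_self)
qed

text \<open>At index 0 all permutations coincide and the sums containing \<open>h\<close> are empty.
  The current relations become 2 or 6 times the finite ones, and an entry -3 is excluded by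
  \<open>triple_bond\<close>.\<close>

lemma kills_current_imp_finite:
  assumes "kills (current_serre_relators c d)" and "\<not> type_G2 c"
  shows "kills (finite_serre_relators c)"
proof (rule kills_finite_serre_I)
  note killed = assms(1)[unfolded kills_def current_serre_relators_def, rule_format]
  fix i j
  show "comm (b i 0) (b j 0) = 0" if "c i j = 0"
  proof -
    have "\<pi> (comm (b_gen i 0) (b_gen j 0)) = 0"
      by (rule killed) (use that in blast)
    then show ?thesis unfolding \<pi>_simps .
  qed
  show "comm (b i 0) (comm (b i 0) (b j 0)) = - b j 0" if "c i j = -1"
  proof -
    define X Y where "X = comm (b i 0) (comm (b i 0) (b j 0))" and "Y = b j 0"
    have "\<pi> (Sym2 (\<lambda>k1 k2. comm (b_gen i k1) (comm (b_gen i k2) (b_gen j 0))) 0 0 - serre1_rhs d i j 0 0 0) = 0"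
      by (rule killed) (use that in blast)
    moreover have "sc [:- 1:] = - 1" using sc_sign[of 1] by simp
    moreover have "sc (monom 2 0) = 2" by (simp add: monom_0 sc_const_numeral)
    ultimately have eq: "X + X + 2 * Y = 0"
      by (simp add: Sym2_def serre1_rhs_def \<pi>_simps X_def Y_def)
    have "2 * X = (X + X + 2 * Y) + 2 * - Y"
      by (rule null_elem_inject) (simp only: null_elem_expand; simp)
    then have "2 * X = 2 * - Y" unfolding eq by simp
    then show ?thesis unfolding X_def Y_def by (rule numeral_mult_cancel)
  qed
  show "comm (b i 0) (comm (b i 0) (comm (b i 0) (b j 0))) = - (4 * comm (b i 0) (b j 0))" if "c i j = -2"
  proof -
    define X Y where "X = comm (b i 0) (comm (b i 0) (comm (b i 0) (b j 0)))" and "Y = comm (b i 0) (b j 0)"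
    have "\<pi> (Sym3 (\<lambda>k1 k2 k3. comm (b_gen i k1) (comm (b_gen i k2) (comm (b_gen i k3) (b_gen j 0)))) 0 0 0
       - serre2_rhs d i j 0 0 0 0) = 0"
      by (rule killed) (use that in blast)
    moreover have "sc (monom (- 1) 0) = - 1" using sc_sign[of 1] by (simp add: monom_0)
    ultimately have eq: "X + X + X + X + X + X + (8 * Y + 8 * Y + 8 * Y) = 0"
      by (simp add: Sym3_def serre2_rhs_def Cyc3_def \<pi>_simps sc_const_numeral X_def Y_def)
    have "6 * X = (X + X + X + X + X + X + (8 * Y + 8 * Y + 8 * Y)) + 6 * - (4 * Y)"
      by (rule null_elem_inject) (simp only: null_elem_expand; simp)
    then have "6 * X = 6 * - (4 * Y)" unfolding eq by simp
    then show ?thesis unfolding X_def Y_def by (rule numeral_mult_cancel)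
  qed
  show "comm (b i 0) (comm (b i 0) (comm (b i 0) (comm (b i 0) (b j 0)))) =
      - (10 * comm (b i 0) (comm (b i 0) (b j 0))) - 9 * b j 0" if "c i j = -3"
    using triple_bond[OF that] assms(2) by blast
qed

lemma kills_G2_imp_finite:
  assumes "kills (G2_serre_relators c)" and "type_G2 c"
  shows "kills (finite_serre_relators c)"
proof (rule kills_finite_serre_I)
  note killed = assms(1)[unfolded kills_def G2_serre_relators_def, rule_format]
  fix i j
  have entries: "c i j \<in> {2, -1, -3}"
  proof -
    from assms(2) obtain p q where univ: "UNIV = {p, q}" and pq: "c q p = -3" "c p q = -1"
      unfolding type_G2_def by blast
    have "i \<in> {p, q}" "j \<in> {p, q}"
      unfolding univ[symmetric] by (rule UNIV_I)+
    then show ?thesis using pq diag[of p] diag[of q] by (elim insertE emptyE) simp_all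
  qed
  show "comm (b i 0) (b j 0) = 0" if "c i j = 0"
    using entries that by simp
  show "comm (b i 0) (comm (b i 0) (comm (b i 0) (b j 0))) = - (4 * comm (b i 0) (b j 0))" if "c i j = -2"
    using entries that by simp
  show "comm (b i 0) (comm (b i 0) (b j 0)) = - b j 0" if "c i j = -1"
  proof -
    have "\<pi> (comm (b_gen i 0) (comm (b_gen i 0) (b_gen j 0)) - (- b_gen j 0)) = 0"
      by (rule killed) (use that in blast)
    then show ?thesis unfolding \<pi>_simps by (simp add: eq_neg_iff_add_eq_0)
  qed
  show "comm (b i 0) (comm (b i 0) (comm (b i 0) (comm (b i 0) (b j 0)))) =
      - (10 * comm (b i 0) (comm (b i 0) (b j 0))) - 9 * b j 0" if "c i j = -3"
  proof -
    have "\<pi> (comm (b_gen i 0) (comm (b_gen i 0) (comm (b_gen i 0) (comm (b_gen i 0) (b_gen j 0))))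
       - (- ([:10:] \<cdot> comm (b_gen i 0) (comm (b_gen i 0) (b_gen j 0))) - [:9:] \<cdot> b_gen j 0)) = 0"
      by (rule killed) (use that in blast)
    then show ?thesis unfolding \<pi>_simps sc_const_numeral by (simp only: eq_iff_diff_eq_0[symmetric])
  qed
qed

end

section \<open>Equality of the two ideals\<close>

lemma central_scalars_free_alg: "central_scalars (\<lambda>p. const_class (scal p :: 'x free_alg))"
proof
  fix p and y :: "'x free_alg quotient_product"
  show "const_class (scal p) * y = y * const_class (scal p)"
    by (rule const_class_central) (rule scal_central)
qed (simp_all only: scal_hom const_class_simps)

text \<open>Membership in an ideal \<open>J Y\<close> is the vanishing of
  \<open>class_at (J Y)\<close>. Each inclusion is therefore an implication between relations in the
  image of one homomorphism.\<close>

lemma genideal_eq: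
  assumes "indecomposable_finite_cartan_matrix c" and d: "coprime_symmetrizer c d"
  defines "X \<equiv> (if type_G2 c then G2_serre_relators c else current_serre_relators c d)"
  shows "genideal free_algebra (common_relators c d \<union> X) =
    genideal free_algebra (common_relators c d \<union> finite_serre_relators c)"
proof -
  obtain e where e: "finite_cartan c e"
    using assms(1) by (rule finite_cartan_if_indecomposable_finite)
  define J where "J = (\<lambda>Y. genideal free_algebra (common_relators c d \<union> Y))"
  have J: "two_sided_ideal (J Y)" for Y
    unfolding J_def by (rule two_sided_ideal_genideal)
  have common: "common_relators c d \<subseteq> J Y" and sub: "Y \<subseteq> J Y" for Y
    using genideal_free_algebra_superset[of "common_relators c d \<union> Y"] by (simp_all add: J_def)
  have quot: "finite_yangian_quotient (\<lambda>p. const_class (scal p)) c d (class_at (J Y)) e" for Y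
  proof -
    interpret central_scalars "\<lambda>p. const_class (scal p :: 'a yfree)" by (rule central_scalars_free_alg)
    interpret finite_cartan c e by (fact e)
    show ?thesis
    proof unfold_locales
      fix p u v
      show "class_at (J Y) (u + v) = class_at (J Y) u + class_at (J Y) v"
        "class_at (J Y) (u * v) = class_at (J Y) u * class_at (J Y) v"
        "class_at (J Y) (p \<cdot> u) = const_class (scal p) * class_at (J Y) u"
        unfolding smul_def by (rule class_at_simps)+
    next
      fix u assume "u \<in> common_relators c d"
      then have "u \<in> J Y" by (rule subsetD[OF common])
      then show "class_at (J Y) u = 0" by (simp only: class_at_eq_0_iff[OF J])
    qed (fact d)
  qed
  have kills: "yangian_quotient.kills (class_at (J Y)) Z \<longleftrightarrow> Z \<subseteq> J Y" for Y Z
  proof -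
    interpret finite_yangian_quotient "\<lambda>p. const_class (scal p)" c d "class_at (J Y)" e by (fact quot)
    show ?thesis by (auto simp: kills_def class_at_eq_0_iff[OF J])
  qed
  have "finite_serre_relators c \<subseteq> J X"
  proof -
    interpret finite_yangian_quotient "\<lambda>p. const_class (scal p)" c d "class_at (J X)" e by (fact quot)
    have "kills X" unfolding kills by (rule sub)
    then have "kills (finite_serre_relators c)"
      using kills_current_imp_finite kills_G2_imp_finite by (auto simp: X_def split: if_splits)
    then show ?thesis unfolding kills .
  qed
  moreover have "X \<subseteq> J (finite_serre_relators c)"
  proof -
    interpret finite_yangian_quotient "\<lambda>p. const_class (scal p)" c d "class_at (J (finite_serre_relators c))" e
      by (fact quot)
    have "kills (finite_serre_relators c)" unfolding kills by (rule sub)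
    then have "kills X"
      using kills_finite_imp_G2 kills_finite_imp_current by (simp add: X_def)
    then show ?thesis unfolding kills .
  qed
  ultimately have "common_relators c d \<union> finite_serre_relators c \<subseteq> J X"
    "common_relators c d \<union> X \<subseteq> J (finite_serre_relators c)"
    by (simp_all only: Un_least common)
  then show ?thesis
    unfolding J_def by (intro equalityI genideal_free_algebra_minimal)
qed

theorem theoremC:
  fixes scale :: "complex \<Rightarrow> 'g::ab_group_add \<Rightarrow> 'g"
    and bracket :: "'g \<Rightarrow> 'g \<Rightarrow> 'g"
    and c :: "'i::finite \<Rightarrow> 'i \<Rightarrow> int"
    and d :: "'i \<Rightarrow> nat"
  assumes "simple_complex_lie_algebra scale bracket"
    and "complex_lie_algebra.has_cartan_matrix scale bracket c"
    and "coprime_symmetrizer c d"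
  shows "algebra_isomorphic (twisted_yangian c d) (reduced_twisted_yangian c d)"
proof -
  interpret simple_complex_lie_algebra scale bracket by (fact assms(1))
  have "indecomposable_finite_cartan_matrix c"
    using assms(2) by (simp add: has_cartan_matrix_def)
  from genideal_eq[OF this assms(3)] show ?thesis
    by (simp only: twisted_yangian_def reduced_twisted_yangian_def presented_algebra_def algebra_isomorphic_refl)
qed

end
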